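(* Let $X$ be a set. With respect to the semilattice $F=E(\mathcal{J}_X)\subseteq\mathcal{P}_X$: (i) for every equivalence relation $\varepsilon$ on $X$, the $\mathscr{H}^F$-class $H^F_{\mathrm{id}_\varepsilon}$ of $\mathrm{id}_\varepsilon$ in $\mathcal{P}_X$ is a monoid (under the product of $\mathcal{P}_X$, with identity $\mathrm{id}_\varepsilon$) isomorphic to the symmetric inverse monoid $\mathcal{I}_{X/\varepsilon}$ of all partial bijections of the set $X/\varepsilon$ of $\varepsilon$-classes; (ii) the inverse monoid $\mathrm{Reg}_F(\mathcal{P}_X)$ of all $F$-regular elements of $\mathcal{P}_X$ is the dual symmetric inverse monoid $\mathcal{J}_X$.
   Context: Partition monoid: let $X$ be a set and $X'=\{x':x\in X\}$ a disjoint copy of $X$. $\mathcal{P}_X$ is the set of all set partitions of $X\cup X'$. Given $\alpha,\beta\in\mathcal{P}_X$, let $X''=\{x'':x\in X\}$ be another disjoint copy; represent $\alpha$ and $\beta$ by graphs on $X\cup X'$ whose connected components are the blocks; rename each lower vertex $x'$ of $\alpha$ to $x''$ and each upper vertex $x$ of $\beta$ to $x''$; take the union of these graphs on $X\cup X''\cup X'$. The product $\alpha\beta$ is the partition of $X\cup X'$ in which two elements lie in the same block iff they are joined by a path in this union graph. This makes $\mathcal{P}_X$ a monoid. A block is a transversal if it meets both $X$ and $X'$. $\mathrm{dom}(\alpha)$ (resp. $\mathrm{codom}(\alpha)$) is the set of $x\in X$ such that $x$ (resp. $x'$) belongs to a transversal of $\alpha$. The dual symmetric inverse monoid is the submonoid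 $\mathcal{J}_X=\{\alpha\in\mathcal{P}_X:\mathrm{dom}(\alpha)=\mathrm{codom}(\alpha)=X\}$. For an equivalence $\varepsilon$ on $X$, $\mathrm{id}_\varepsilon=\{A\cup A':A\in X/\varepsilon\}$. The idempotents of $\mathcal{J}_X$ are exactly the $\mathrm{id}_\varepsilon$, and they form a semilattice $F=E(\mathcal{J}_X)$. For $\alpha\in\mathcal{P}_X$ let $F_L(\alpha)=\{e\in F:\alpha=e\alpha\}$ and $F_R(\alpha)=\{e\in F:\alpha=\alpha e\}$. Define $\alpha\,\mathscr{R}^F\,\beta\iff F_L(\alpha)=F_L(\beta)$, $\alpha\,\mathscr{L}^F\,\beta\iff F_R(\alpha)=F_R(\beta)$, and $\mathscr{H}^F=\mathscr{R}^F\cap\mathscr{L}^F$. An element $\alpha\in\mathcal{P}_X$ is $F$-regular if $\alpha\,\mathscr{R}\,e$ and $\alpha\,\mathscr{L}\,f$ for some $e,f\in F$, where $\mathscr{R},\mathscr{L}$ are the usual Green's relations on $\mathcal{P}_X$ ($x\,\mathscr{R}\,y$ iff $x,y$ generate the same principal right ideal; $x\,\mathscr{L}\,y$ iff they generate the same principal left ideal). $\mathrm{Reg}_F(\mathcal{P}_X)$ is the set of all $F$-regular elements. *)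

theory Defs
  imports "HOL-Algebra.Coset" "HOL-Library.Disjoint_Sets"
begin

section \<open>The partition monoid\<close>

text \<open>
  The disjoint union of \<open>X\<close> and its copy \<open>X'\<close> is \<open>X <+> X\<close>:
  \<open>Inl x\<close> is the upper vertex \<open>x\<close> and \<open>Inr x\<close> is the lower vertex \<open>x'\<close>.
\<close>

definition partitions :: "'a set \<Rightarrow> ('a + 'a) set set set" where
  "partitions X = {\<alpha>. partition_on (X <+> X) \<alpha>}"

text \<open>Vertices \<open>x\<close>, \<open>x''\<close> and \<open>x'\<close> of the product graph.\<close>

datatype 'a vertex = Up 'a | Mid 'a | Low 'a

text \<open>
  A partition is represented by the graph in which any two elements of a block are
  adjacent; its connected components are the blocks.
\<close>

definition block_edges :: "('a + 'a \<Rightarrow> 'a vertex) \<Rightarrow> ('a + 'a) set set \<Rightarrow> ('a vertex \<times> 'a vertex) set" where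
  "block_edges f \<alpha> = {(f u, f v) | u v. \<exists>A\<in>\<alpha>. u \<in> A \<and> v \<in> A}"

definition product_graph :: "('a + 'a) set set \<Rightarrow> ('a + 'a) set set \<Rightarrow> ('a vertex \<times> 'a vertex) set" where
  "product_graph \<alpha> \<beta> = block_edges (case_sum Up Mid) \<alpha> \<union> block_edges (case_sum Mid Low) \<beta>"

definition partition_mult :: "'a set \<Rightarrow> ('a + 'a) set set \<Rightarrow> ('a + 'a) set set \<Rightarrow> ('a + 'a) set set" where
  "partition_mult X \<alpha> \<beta> =
     (X <+> X) // {(u, v). u \<in> X <+> X \<and> v \<in> X <+> X \<and>
       (case_sum Up Low u, case_sum Up Low v) \<in> (product_graph \<alpha> \<beta>)\<^sup>*}"

text \<open>\<open>A <+> A\<close> is the block \<open>A \<union> A'\<close>.\<close>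

definition id_equiv :: "'a set \<Rightarrow> ('a \<times> 'a) set \<Rightarrow> ('a + 'a) set set" where
  "id_equiv X \<epsilon> = (\<lambda>A. A <+> A) ` (X // \<epsilon>)"

definition partition_monoid :: "'a set \<Rightarrow> ('a + 'a) set set monoid" where
  "partition_monoid X =
     \<lparr>carrier = partitions X, mult = partition_mult X, one = id_equiv X (Id_on X)\<rparr>"

section \<open>The dual symmetric inverse monoid\<close>

definition transversal :: "('a + 'a) set \<Rightarrow> bool" where
  "transversal A \<longleftrightarrow> A \<inter> range Inl \<noteq> {} \<and> A \<inter> range Inr \<noteq> {}"

definition dom_part :: "('a + 'a) set set \<Rightarrow> 'a set" where
  "dom_part \<alpha> = {x. \<exists>A\<in>\<alpha>. transversal A \<and> Inl x \<in> A}"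

definition codom_part :: "('a + 'a) set set \<Rightarrow> 'a set" where
  "codom_part \<alpha> = {x. \<exists>A\<in>\<alpha>. transversal A \<and> Inr x \<in> A}"

definition dual_sym_inv :: "'a set \<Rightarrow> ('a + 'a) set set set" where
  "dual_sym_inv X = {\<alpha> \<in> partitions X. dom_part \<alpha> = X \<and> codom_part \<alpha> = X}"

definition idempotents :: "('a, 'b) monoid_scheme \<Rightarrow> 'a set \<Rightarrow> 'a set" where
  "idempotents G S = {e \<in> S. e \<otimes>\<^bsub>G\<^esub> e = e}"

definition E_dual_sym_inv :: "'a set \<Rightarrow> ('a + 'a) set set set" where
  "E_dual_sym_inv X = idempotents (partition_monoid X) (dual_sym_inv X)"

section \<open>Green's relations and their analogues relative to a set \<open>F\<close> of idempotents\<close>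

text \<open>\<open>a <# carrier G\<close> and \<open>carrier G #> a\<close> are the principal right and left ideals of \<open>a\<close>.\<close>

definition green_R :: "('a, 'b) monoid_scheme \<Rightarrow> 'a \<Rightarrow> 'a \<Rightarrow> bool" where
  "green_R G a b \<longleftrightarrow> a <#\<^bsub>G\<^esub> carrier G = b <#\<^bsub>G\<^esub> carrier G"

definition green_L :: "('a, 'b) monoid_scheme \<Rightarrow> 'a \<Rightarrow> 'a \<Rightarrow> bool" where
  "green_L G a b \<longleftrightarrow> carrier G #>\<^bsub>G\<^esub> a = carrier G #>\<^bsub>G\<^esub> b"

definition F_left :: "('a, 'b) monoid_scheme \<Rightarrow> 'a set \<Rightarrow> 'a \<Rightarrow> 'a set" where
  "F_left G F a = {e \<in> F. a = e \<otimes>\<^bsub>G\<^esub> a}"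

definition F_right :: "('a, 'b) monoid_scheme \<Rightarrow> 'a set \<Rightarrow> 'a \<Rightarrow> 'a set" where
  "F_right G F a = {e \<in> F. a = a \<otimes>\<^bsub>G\<^esub> e}"

definition R_F :: "('a, 'b) monoid_scheme \<Rightarrow> 'a set \<Rightarrow> 'a \<Rightarrow> 'a \<Rightarrow> bool" where
  "R_F G F a b \<longleftrightarrow> F_left G F a = F_left G F b"

definition L_F :: "('a, 'b) monoid_scheme \<Rightarrow> 'a set \<Rightarrow> 'a \<Rightarrow> 'a \<Rightarrow> bool" where
  "L_F G F a b \<longleftrightarrow> F_right G F a = F_right G F b"

definition H_F :: "('a, 'b) monoid_scheme \<Rightarrow> 'a set \<Rightarrow> 'a \<Rightarrow> 'a \<Rightarrow> bool" where
  "H_F G F a b \<longleftrightarrow> R_F G F a b \<and> L_F G F a b"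

definition H_F_class :: "('a, 'b) monoid_scheme \<Rightarrow> 'a set \<Rightarrow> 'a \<Rightarrow> 'a set" where
  "H_F_class G F a = {b \<in> carrier G. H_F G F b a}"

definition Reg_F :: "('a, 'b) monoid_scheme \<Rightarrow> 'a set \<Rightarrow> 'a set" where
  "Reg_F G F = {a \<in> carrier G. (\<exists>e\<in>F. green_R G a e) \<and> (\<exists>f\<in>F. green_L G a f)}"

section \<open>Inverse monoids\<close>

definition inverse_monoid :: "('a, 'b) monoid_scheme \<Rightarrow> bool" where
  "inverse_monoid G \<longleftrightarrow> monoid G \<and>
     (\<forall>a\<in>carrier G. \<exists>!b. b \<in> carrier G \<and>
        a \<otimes>\<^bsub>G\<^esub> b \<otimes>\<^bsub>G\<^esub> a = a \<and> b \<otimes>\<^bsub>G\<^esub> a \<otimes>\<^bsub>G\<^esub> b = b)"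

text \<open>
  Partial bijections are given by their graphs and composed from left to right, in
  accordance with the product of partitions.
\<close>

definition sym_inv_monoid :: "'a set \<Rightarrow> ('a \<times> 'a) set monoid" where
  "sym_inv_monoid Y =
     \<lparr>carrier = {f. f \<subseteq> Y \<times> Y \<and> single_valued f \<and> single_valued (f\<inverse>)},
      mult = (O), one = Id_on Y\<rparr>"

end

theory Submission
  imports Defs
begin

text \<open>
  The proof embeds the partition monoid into the monoid of binary relations on the power set
  of \<open>X\<close>. To a partition \<open>\<alpha>\<close> belongs the relation \<open>sat_rel X \<alpha>\<close> of all pairs \<open>(U, L)\<close> for which
  \<open>U \<union> L'\<close> is a union of blocks. A partition is determined by its unions of blocks
  (\<open>sat_rel_inject\<close>). The product of partitions becomes composition of relations
  (\<open>sat_rel_partition_mult\<close>): a set of vertices of the product graph is a union of components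
  iff its upper and middle parts form a union of blocks of \<open>\<alpha>\<close> and its middle and lower parts a
  union of blocks of \<open>\<beta>\<close>. Paths in the product graph matter only for that step; associativity, for
  instance, is afterwards inherited from composition of relations.

  Under this embedding the objects of the theorem become familiar. Exchanging the two copies of
  \<open>X\<close> gives the converse relation; \<open>id_equiv X \<epsilon>\<close> gives the partial identity on the \<open>\<epsilon>\<close>-saturated
  sets; and \<open>dual_sym_inv X\<close> consists of exactly those partitions whose relation is a partial
  bijection (\<open>dual_sym_inv_iff\<close>). Since an idempotent partial bijection is a partial identity,
  \<open>F\<close> consists of the \<open>id_equiv X \<epsilon>\<close> (\<open>E_dual_sym_inv_eq\<close>).

  For the second part, a partial bijection \<open>f\<close> satisfies \<open>f O f\<inverse> = Id_on (Domain f)\<close>, so an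
  element of \<open>dual_sym_inv X\<close> is \<open>\<R>\<close>-related to the identity of its kernel and, dually,
  \<open>\<L>\<close>-related to that of its cokernel. Conversely, if \<open>id_equiv X \<epsilon> = \<alpha>\<gamma>\<close>, then every upper vertex
  lies in a transversal of \<open>\<alpha>\<gamma>\<close>, hence in one of \<open>\<alpha>\<close>. The inverse monoid property is that of
  partial bijections.

  For the first part, \<open>id_equiv X \<delta>\<close> is a left identity for \<open>\<alpha>\<close> iff the domain of \<open>sat_rel X \<alpha>\<close>,
  that is, the set of all sets saturated under the kernel of \<open>\<alpha>\<close>, consists of \<open>\<delta>\<close>-saturated sets.
  So the class of \<open>id_equiv X \<epsilon>\<close> consists of the partitions with kernel and cokernel \<open>\<epsilon>\<close>
  (\<open>H_F_class_id_equiv\<close>). A block of such a partition is \<open>A\<close>, \<open>B'\<close> or \<open>A \<union> B'\<close> with classes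
  \<open>A\<close> and \<open>B\<close>, and the blocks of the last form are the graph of a partial bijection of \<open>X // \<epsilon>\<close>,
  which can be prescribed freely and is multiplicative.
\<close>

section \<open>Unions of blocks\<close>

text \<open>
  Being a union of blocks is phrased locally, block by block, so that it matches closure under
  the edges of a graph.
\<close>

definition sat_rel :: "'a set \<Rightarrow> ('a + 'a) set set \<Rightarrow> ('a set \<times> 'a set) set" where
  "sat_rel X \<alpha> = {(U, L). U \<subseteq> X \<and> L \<subseteq> X \<and> (\<forall>A\<in>\<alpha>. A \<subseteq> U <+> L \<or> A \<inter> (U <+> L) = {})}"

definition saturated :: "'a set \<Rightarrow> ('a \<times> 'a) set \<Rightarrow> 'a set set" where
  "saturated X \<epsilon> = {U. U \<subseteq> X \<and> \<epsilon> `` U \<subseteq> U}"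

definition ker_part :: "('a + 'a) set set \<Rightarrow> ('a \<times> 'a) set" where
  "ker_part \<alpha> = {(x, y). \<exists>A\<in>\<alpha>. Inl x \<in> A \<and> Inl y \<in> A}"

definition coker_part :: "('a + 'a) set set \<Rightarrow> ('a \<times> 'a) set" where
  "coker_part \<alpha> = {(x, y). \<exists>A\<in>\<alpha>. Inr x \<in> A \<and> Inr y \<in> A}"

text \<open>The image of a partition under the exchange of the two copies of \<open>X\<close>.\<close>
definition flip_part :: "('a + 'a) set set \<Rightarrow> ('a + 'a) set set" where
  "flip_part \<alpha> = (\<lambda>A. (case_sum Inr Inl) ` A) ` \<alpha>"

lemma Plus_vimage: "(Inl -` A) <+> (Inr -` A) = A"
proof (rule Set.set_eqI)
  fix u show "u \<in> (Inl -` A) <+> (Inr -` A) \<longleftrightarrow> u \<in> A" by (cases u) auto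
qed

lemma Plus_eq_iff: "A <+> B = C <+> D \<longleftrightarrow> A = C \<and> B = D"
proof
  have "Inl -` (S <+> T) = S" "Inr -` (S <+> T) = T" for S :: "'c set" and T :: "'d set"
    by auto
  then show "A <+> B = C <+> D \<Longrightarrow> A = C \<and> B = D" by metis
qed simp

lemma flip_mem: 
  fixes A :: "('a + 'b) set"
  shows "u \<in> case_sum Inr Inl ` A \<longleftrightarrow> case_sum Inr Inl u \<in> A"
proof
  have flip: "case_sum Inr Inl (case_sum Inr Inl w) = w" for w :: "'a + 'b"
    by (cases w) auto
  have flip': "case_sum Inr Inl (case_sum Inr Inl w) = w" for w :: "'b + 'a"
    by (cases w) auto
  show "case_sum Inr Inl u \<in> A" if "u \<in> case_sum Inr Inl ` A"
    using that flip by auto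
  show "u \<in> case_sum Inr Inl ` A" if "case_sum Inr Inl u \<in> A"
    using that flip' by (metis imageI)
qed

lemma partitions_ex_block:
  assumes "\<alpha> \<in> partitions X" "u \<in> X <+> X"
  obtains A where "A \<in> \<alpha>" "u \<in> A"
  using assms by (auto simp: partitions_def partition_on_def)

lemma partitions_unique_block:
  assumes "\<alpha> \<in> partitions X" "A \<in> \<alpha>" "B \<in> \<alpha>" "u \<in> A" "u \<in> B"
  shows "A = B"
  using assms by (auto simp: partitions_def partition_on_def disjoint_def)

lemma partitions_block_subset:
  assumes "\<alpha> \<in> partitions X" "A \<in> \<alpha>" shows "A \<subseteq> X <+> X"
  using assms by (auto simp: partitions_def partition_on_def)

lemma sat_relI:
  assumes "U \<subseteq> X" "L \<subseteq> X" 
    "\<And>A u v. \<lbrakk>A \<in> \<alpha>; u \<in> A; v \<in> A; u \<in> U <+> L\<rbrakk> \<Longrightarrow> v \<in> U <+> L"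
  shows "(U, L) \<in> sat_rel X \<alpha>"
  unfolding sat_rel_def using assms by blast

lemma sat_relD:
  assumes "(U, L) \<in> sat_rel X \<alpha>" "A \<in> \<alpha>" "u \<in> A" "u \<in> U <+> L"
  shows "A \<subseteq> U <+> L"
  using assms unfolding sat_rel_def by blast

lemma sat_rel_subset: "sat_rel X \<alpha> \<subseteq> Pow X \<times> Pow X"
  by (auto simp: sat_rel_def)

lemma sat_rel_block:
  assumes "\<alpha> \<in> partitions X" "U <+> L \<in> \<alpha>"
  shows "(U, L) \<in> sat_rel X \<alpha>"
proof (rule sat_relI)
  show "U \<subseteq> X" "L \<subseteq> X" using partitions_block_subset[OF assms] by auto
  show "v \<in> U <+> L" if "A \<in> \<alpha>" "u \<in> A" "v \<in> A" "u \<in> U <+> L" for A u v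
    using partitions_unique_block[OF assms(1) that(1) assms(2) that(2,4)] that(3) by simp
qed

lemma sat_rel_empty: "({}, {}) \<in> sat_rel X \<alpha>"
  by (rule sat_relI) auto

text \<open>
  A block of \<open>\<alpha>\<close> is a minimal nonempty union of blocks. If \<open>\<alpha>\<close> and \<open>\<beta>\<close> have the same unions of
  blocks, then intersecting blocks of \<open>\<alpha>\<close> and \<open>\<beta>\<close> contain each other.
\<close>

lemma sat_rel_eq_imp_block:
  assumes a: "\<alpha> \<in> partitions X" and b: "\<beta> \<in> partitions X"
    and eq: "sat_rel X \<alpha> = sat_rel X \<beta>" and A: "A \<in> \<alpha>"
  shows "A \<in> \<beta>"
proof -
  from a A obtain u where u: "u \<in> A" by (metis (mono_tags) all_not_in_conv mem_Collect_eq partition_on_def partitions_def)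
  have "u \<in> X <+> X" using partitions_block_subset[OF a A] u by blast
  then obtain B where B: "B \<in> \<beta>" "u \<in> B" using partitions_ex_block[OF b] by blast
  have "(Inl -` A, Inr -` A) \<in> sat_rel X \<beta>"
    using sat_rel_block[OF a, of "Inl -` A" "Inr -` A"] A eq by (simp add: Plus_vimage)
  from sat_relD[OF this B] u have "B \<subseteq> A" by (simp add: Plus_vimage)
  moreover have "(Inl -` B, Inr -` B) \<in> sat_rel X \<alpha>"
    using sat_rel_block[OF b, of "Inl -` B" "Inr -` B"] B eq by (simp add: Plus_vimage)
  from sat_relD[OF this A u] B have "A \<subseteq> B" by (simp add: Plus_vimage)
  ultimately show ?thesis using B by simp
qed

lemma sat_rel_inject:
  assumes "\<alpha> \<in> partitions X" "\<beta> \<in> partitions X" "sat_rel X \<alpha> = sat_rel X \<beta>"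
  shows "\<alpha> = \<beta>"
  using sat_rel_eq_imp_block[OF assms] sat_rel_eq_imp_block[OF assms(2,1) assms(3)[symmetric]]
  by blast

section \<open>The product as composition of relations\<close>

definition product_equiv :: "'a set \<Rightarrow> ('a + 'a) set set \<Rightarrow> ('a + 'a) set set \<Rightarrow> (('a + 'a) \<times> ('a + 'a)) set" where
  "product_equiv X \<alpha> \<beta> = {(u, v). u \<in> X <+> X \<and> v \<in> X <+> X \<and>
       (case_sum Up Low u, case_sum Up Low v) \<in> (product_graph \<alpha> \<beta>)\<^sup>*}"

lemma equiv_product_equiv: "equiv (X <+> X) (product_equiv X \<alpha> \<beta>)"
proof (rule equivI)
  have "sym (product_graph \<alpha> \<beta>)"
    unfolding sym_def product_graph_def block_edges_def by blast
  then have "sym ((product_graph \<alpha> \<beta>)\<^sup>*)" by (rule sym_rtrancl)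
  then show "sym (product_equiv X \<alpha> \<beta>)"
    unfolding product_equiv_def sym_def by blast
  show "trans (product_equiv X \<alpha> \<beta>)"
    unfolding product_equiv_def trans_def by (auto intro: rtrancl_trans)
qed (auto simp: product_equiv_def refl_on_def)

lemma partition_mult_eq: "partition_mult X \<alpha> \<beta> = (X <+> X) // product_equiv X \<alpha> \<beta>"
  by (simp add: partition_mult_def product_equiv_def)

lemma partition_mult_closed: "partition_mult X \<alpha> \<beta> \<in> partitions X"
  unfolding partitions_def partition_mult_eq
  using partition_on_quotient[OF equiv_product_equiv] by blast

lemma sat_rel_quotient:
  assumes "equiv (X <+> X) r"
  shows "(U, L) \<in> sat_rel X ((X <+> X) // r) \<longleftrightarrow> U \<subseteq> X \<and> L \<subseteq> X \<and> r `` (U <+> L) \<subseteq> U <+> L"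
proof (intro iffI conjI)
  assume sat: "(U, L) \<in> sat_rel X ((X <+> X) // r)"
  then show UL: "U \<subseteq> X" "L \<subseteq> X" by (auto simp: sat_rel_def)
  show "r `` (U <+> L) \<subseteq> U <+> L"
  proof
    fix v assume "v \<in> r `` (U <+> L)"
    then obtain u where u: "u \<in> U <+> L" "(u, v) \<in> r" by blast
    have "u \<in> X <+> X" using u UL by auto
    from sat_relD[OF sat quotientI[OF this] equiv_class_self[OF assms this] u(1)] u(2) show "v \<in> U <+> L" by blast
  qed
next
  assume *: "U \<subseteq> X \<and> L \<subseteq> X \<and> r `` (U <+> L) \<subseteq> U <+> L"
  show "(U, L) \<in> sat_rel X ((X <+> X) // r)"
  proof (rule sat_relI)
    fix A u v assume "A \<in> (X <+> X) // r" "u \<in> A" "v \<in> A" "u \<in> U <+> L"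
    moreover from this have "(u, v) \<in> r" using assms by (metis in_quotient_imp_in_rel insert_subset empty_subsetI)
    ultimately show "v \<in> U <+> L" using * by blast
  qed (use * in auto)
qed

text \<open>
  Given a union of components of the product graph, restricted to the outer vertices, the
  middle set witnessing the composition consists of the middle vertices reachable from it.
  Conversely, the three sets coming from a pair in the composition together are closed under
  all edges of the product graph, hence under paths.
\<close>

lemma sat_rel_partition_mult:
  assumes a: "\<alpha> \<in> partitions X" and b: "\<beta> \<in> partitions X"
  shows "sat_rel X (partition_mult X \<alpha> \<beta>) = sat_rel X \<alpha> O sat_rel X \<beta>"
proof (intro equalityI subrelI)
  let ?G = "product_graph \<alpha> \<beta>"
  fix U L assume "(U, L) \<in> sat_rel X (partition_mult X \<alpha> \<beta>)"
  then have UL: "U \<subseteq> X" "L \<subseteq> X" and cl: "product_equiv X \<alpha> \<beta> `` (U <+> L) \<subseteq> U <+> L"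
    unfolding partition_mult_eq sat_rel_quotient[OF equiv_product_equiv] by auto
  define S where "S = ?G\<^sup>* `` (case_sum Up Low ` (U <+> L))"
  define M where "M = {x \<in> X. Mid x \<in> S}"
  \<comment> \<open>Reachability adds no new outer vertices, because \<open>U <+> L\<close> is already a union of components.\<close>
  have outer: "u \<in> U <+> L \<longleftrightarrow> case_sum Up Low u \<in> S" if u: "u \<in> X <+> X" for u
  proof
    assume "case_sum Up Low u \<in> S"
    then obtain w where w: "w \<in> U <+> L" "(case_sum Up Low w, case_sum Up Low u) \<in> ?G\<^sup>*"
      unfolding S_def by blast
    moreover have "w \<in> X <+> X" using w UL by auto
    ultimately have "(w, u) \<in> product_equiv X \<alpha> \<beta>" using u by (simp add: product_equiv_def)
    then show "u \<in> U <+> L" using cl w by blast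
  qed (auto simp: S_def)
  have step: "y \<in> S" if "x \<in> S" "(x, y) \<in> ?G" for x y
    using that unfolding S_def by (auto intro: rtrancl_into_rtrancl)
  have up: "u \<in> U <+> M \<longleftrightarrow> case_sum Up Mid u \<in> S" if "u \<in> X <+> X" for u
    using that outer[of u] by (cases u) (auto simp: M_def)
  have low: "u \<in> M <+> L \<longleftrightarrow> case_sum Mid Low u \<in> S" if "u \<in> X <+> X" for u
    using that outer[of u] by (cases u) (auto simp: M_def)
  have "(U, M) \<in> sat_rel X \<alpha>"
  proof (rule sat_relI)
    fix A u v assume A: "A \<in> \<alpha>" "u \<in> A" "v \<in> A" "u \<in> U <+> M"
    then have "(case_sum Up Mid u, case_sum Up Mid v) \<in> ?G"
      unfolding product_graph_def block_edges_def by blast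
    then show "v \<in> U <+> M" using A up step partitions_block_subset[OF a A(1)] by blast
  qed (use UL in \<open>auto simp: M_def\<close>)
  moreover have "(M, L) \<in> sat_rel X \<beta>"
  proof (rule sat_relI)
    fix A u v assume A: "A \<in> \<beta>" "u \<in> A" "v \<in> A" "u \<in> M <+> L"
    then have "(case_sum Mid Low u, case_sum Mid Low v) \<in> ?G"
      unfolding product_graph_def block_edges_def by blast
    then show "v \<in> M <+> L" using A low step partitions_block_subset[OF b A(1)] by blast
  qed (use UL in \<open>auto simp: M_def\<close>)
  ultimately show "(U, L) \<in> sat_rel X \<alpha> O sat_rel X \<beta>" by blast
next
  let ?G = "product_graph \<alpha> \<beta>"
  fix U L assume "(U, L) \<in> sat_rel X \<alpha> O sat_rel X \<beta>"
  then obtain M where um: "(U, M) \<in> sat_rel X \<alpha>" and ml: "(M, L) \<in> sat_rel X \<beta>" by blast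
  define T where "T = Up ` U \<union> Mid ` M \<union> Low ` L"
  have T: "case_sum Up Mid u \<in> T \<longleftrightarrow> u \<in> U <+> M" "case_sum Mid Low u \<in> T \<longleftrightarrow> u \<in> M <+> L"
    "case_sum Up Low u \<in> T \<longleftrightarrow> u \<in> U <+> L" for u
    by (cases u; auto simp: T_def)+
  have "?G `` T \<subseteq> T"
  proof
    fix y assume "y \<in> ?G `` T"
    then obtain x where x: "x \<in> T" and "(x, y) \<in> ?G" by blast
    then consider A u v where "A \<in> \<alpha>" "u \<in> A" "v \<in> A" "x = case_sum Up Mid u" "y = case_sum Up Mid v"
      | A u v where "A \<in> \<beta>" "u \<in> A" "v \<in> A" "x = case_sum Mid Low u" "y = case_sum Mid Low v"
      unfolding product_graph_def block_edges_def by blast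
    then show "y \<in> T"
    proof cases
      case 1
      with x have "u \<in> U <+> M" using T(1) by blast
      with sat_relD[OF um 1(1,2)] 1 T(1) show ?thesis by blast
    next
      case 2
      with x have "u \<in> M <+> L" using T(2) by blast
      with sat_relD[OF ml 2(1,2)] 2 T(2) show ?thesis by blast
    qed
  qed
  then have "?G\<^sup>* `` T = T" by (rule Image_closed_trancl)
  then have "product_equiv X \<alpha> \<beta> `` (U <+> L) \<subseteq> U <+> L"
    unfolding product_equiv_def using T(3) by blast
  moreover have "U \<subseteq> X" "L \<subseteq> X" using um ml by (auto simp: sat_rel_def)
  ultimately show "(U, L) \<in> sat_rel X (partition_mult X \<alpha> \<beta>)"
    unfolding partition_mult_eq sat_rel_quotient[OF equiv_product_equiv] by blast
qed

lemma id_equiv_closed: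
  assumes "equiv X \<epsilon>" shows "id_equiv X \<epsilon> \<in> partitions X"
proof -
  have d: "disjoint (X // \<epsilon>)" and u: "\<Union> (X // \<epsilon>) = X" and n: "{} \<notin> X // \<epsilon>"
    using partition_on_quotient[OF assms] by (auto simp: partition_on_def)
  have "\<Union> (id_equiv X \<epsilon>) = X <+> X"
    using u unfolding id_equiv_def by auto
  moreover have "disjoint (id_equiv X \<epsilon>)"
  proof (rule disjointI)
    fix S T assume "S \<in> id_equiv X \<epsilon>" "T \<in> id_equiv X \<epsilon>" "S \<noteq> T"
    then obtain A B where "A \<in> X // \<epsilon>" "B \<in> X // \<epsilon>" "A \<noteq> B" "S = A <+> A" "T = B <+> B"
      by (auto simp: id_equiv_def)
    moreover from this have "A \<inter> B = {}" using d by (simp add: disjoint_def)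
    ultimately show "S \<inter> T = {}" by auto
  qed
  moreover have "A <+> A \<noteq> {}" if "A \<in> X // \<epsilon>" for A
    using that n by (auto simp: Plus_eq_empty_conv)
  then have "{} \<notin> id_equiv X \<epsilon>" unfolding id_equiv_def by force
  ultimately show ?thesis by (simp add: partitions_def partition_on_def)
qed

text \<open>
  A union of blocks \<open>C \<union> C'\<close> has the same upper and lower part.
\<close>

lemma sat_rel_id_equiv:
  assumes e: "equiv X \<epsilon>" shows "sat_rel X (id_equiv X \<epsilon>) = Id_on (saturated X \<epsilon>)"
proof (intro equalityI subrelI)
  fix U L assume s: "(U, L) \<in> sat_rel X (id_equiv X \<epsilon>)"
  then have UL: "U \<subseteq> X" "L \<subseteq> X" by (auto simp: sat_rel_def)
  have *: "\<epsilon> `` {x} <+> \<epsilon> `` {x} \<in> id_equiv X \<epsilon>" "x \<in> \<epsilon> `` {x}" if "x \<in> X" for x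
    using that equiv_class_self[OF e] by (auto simp: id_equiv_def intro: quotientI)
  have 1: "\<epsilon> `` {x} \<subseteq> U \<and> \<epsilon> `` {x} \<subseteq> L" if "x \<in> U \<or> x \<in> L" for x
  proof -
    have x: "x \<in> X" using that UL by auto
    have "\<epsilon> `` {x} <+> \<epsilon> `` {x} \<subseteq> U <+> L"
      using that
    proof
      assume "x \<in> U" then show ?thesis
        using sat_relD[OF s *(1)[OF x], of "Inl x"] *(2)[OF x] by blast
    next
      assume "x \<in> L" then show ?thesis
        using sat_relD[OF s *(1)[OF x], of "Inr x"] *(2)[OF x] by blast
    qed
    then show ?thesis by auto
  qed
  have "U = L" using 1 *(2) UL by blast
  moreover have "U \<in> saturated X \<epsilon>" using 1 UL by (auto simp: saturated_def)
  ultimately show "(U, L) \<in> Id_on (saturated X \<epsilon>)" by blast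
next
  fix U L assume "(U, L) \<in> Id_on (saturated X \<epsilon>)"
  then have eq: "L = U" and U: "U \<subseteq> X" "\<epsilon> `` U \<subseteq> U" by (auto simp: saturated_def)
  have "C \<subseteq> U" if "C \<in> X // \<epsilon>" "x \<in> C" "x \<in> U" for C x
    using that U quotient_eq_iff[OF e] in_quotient_imp_in_rel[OF e that(1)] by blast
  then show "(U, L) \<in> sat_rel X (id_equiv X \<epsilon>)"
    unfolding eq using U by (intro sat_relI) (auto simp: id_equiv_def)
qed

lemma saturated_Id_on: "saturated X (Id_on X) = Pow X"
  by (auto simp: saturated_def)

lemma equiv_Id_on: "equiv X (Id_on X)"
  by (auto intro!: equivI simp: refl_on_def sym_def trans_def)

lemma monoid_partition_monoid: "monoid (partition_monoid X)"
proof -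
  have one: "sat_rel X (id_equiv X (Id_on X)) = Id_on (Pow X)"
    by (simp add: sat_rel_id_equiv equiv_Id_on saturated_Id_on)
  show ?thesis
  proof (rule monoidI)
    fix a b c assume "a \<in> carrier (partition_monoid X)" "b \<in> carrier (partition_monoid X)"
      "c \<in> carrier (partition_monoid X)"
    then show "a \<otimes>\<^bsub>partition_monoid X\<^esub> b \<otimes>\<^bsub>partition_monoid X\<^esub> c = a \<otimes>\<^bsub>partition_monoid X\<^esub> (b \<otimes>\<^bsub>partition_monoid X\<^esub> c)"
      by (intro sat_rel_inject[of _ X])
        (simp_all add: partition_monoid_def partition_mult_closed sat_rel_partition_mult O_assoc)
  next
    fix a assume a: "a \<in> carrier (partition_monoid X)"
    have "Id_on (Pow X) O sat_rel X a = sat_rel X a" "sat_rel X a O Id_on (Pow X) = sat_rel X a"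
      using sat_rel_subset[of X a] by blast+
    with a show "\<one>\<^bsub>partition_monoid X\<^esub> \<otimes>\<^bsub>partition_monoid X\<^esub> a = a" "a \<otimes>\<^bsub>partition_monoid X\<^esub> \<one>\<^bsub>partition_monoid X\<^esub> = a"
      by (intro sat_rel_inject[of _ X];
        simp add: partition_monoid_def partition_mult_closed sat_rel_partition_mult id_equiv_closed equiv_Id_on one)+
  qed (simp_all add: partition_monoid_def partition_mult_closed id_equiv_closed equiv_Id_on)
qed

section \<open>Duality, kernels and cokernels\<close>

lemma flip_flip: "flip_part (flip_part \<alpha>) = \<alpha>"
proof -
  have "case_sum Inr Inl ` case_sum Inr Inl ` A = A" for A :: "('a + 'a) set"
    by (rule Set.set_eqI) (simp only: flip_mem, simp split: sum.split)
  then show ?thesis by (simp add: flip_part_def image_image)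
qed

lemma flip_closed:
  assumes "\<alpha> \<in> partitions X" shows "flip_part \<alpha> \<in> partitions X"
proof -
  have bij: "bij_betw (case_sum Inr Inl) (X <+> X) (X <+> X)"
    by (rule bij_betw_byWitness[where f' = "case_sum Inr Inl"]) (auto split: sum.splits)
  then have "partition_on (case_sum Inr Inl ` (X <+> X)) ((`) (case_sum Inr Inl) ` \<alpha> - {{}})"
    using assms by (intro partition_on_inj_image) (auto simp: partitions_def bij_betw_def)
  moreover have "{} \<notin> (`) (case_sum Inr Inl) ` \<alpha>"
    using assms by (auto simp: partitions_def partition_on_def)
  ultimately show ?thesis using bij by (simp add: partitions_def flip_part_def bij_betw_def)
qed

lemma sat_rel_flip_subset: "(sat_rel X \<alpha>)\<inverse> \<subseteq> sat_rel X (flip_part \<alpha>)"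
proof (rule subrelI)
  fix U L assume "(U, L) \<in> (sat_rel X \<alpha>)\<inverse>"
  then have s: "(L, U) \<in> sat_rel X \<alpha>" by simp
  show "(U, L) \<in> sat_rel X (flip_part \<alpha>)"
  proof (rule sat_relI)
    fix A u v assume "A \<in> flip_part \<alpha>" "u \<in> A" "v \<in> A" and u: "u \<in> U <+> L"
    then obtain B where B: "B \<in> \<alpha>" "case_sum Inr Inl u \<in> B" "case_sum Inr Inl v \<in> B"
      unfolding flip_part_def using flip_mem by blast
    have "case_sum Inr Inl u \<in> L <+> U" using u by auto
    from sat_relD[OF s B(1,2) this] B(3) show "v \<in> U <+> L" by (cases v) auto
  qed (use s in \<open>auto simp: sat_rel_def\<close>)
qed

lemma sat_rel_flip: "sat_rel X (flip_part \<alpha>) = (sat_rel X \<alpha>)\<inverse>"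
  using sat_rel_flip_subset[of X \<alpha>] sat_rel_flip_subset[of X "flip_part \<alpha>"]
  by (auto simp: flip_flip)

lemma equiv_ker_part:
  assumes "\<alpha> \<in> partitions X" shows "equiv X (ker_part \<alpha>)"
proof (rule equivI)
  show "refl_on X (ker_part \<alpha>)" 
    using partitions_ex_block[OF assms InlI] unfolding ker_part_def refl_on_def by blast
  show "ker_part \<alpha> \<subseteq> X \<times> X"
    using partitions_block_subset[OF assms] unfolding ker_part_def by blast
  show "sym (ker_part \<alpha>)" by (auto simp: sym_def ker_part_def)
  show "trans (ker_part \<alpha>)"
    using partitions_unique_block[OF assms] unfolding trans_def ker_part_def by blast
qed

lemma coker_part_flip: "coker_part \<alpha> = ker_part (flip_part \<alpha>)"
proof -
  have "Inl x \<in> case_sum Inr Inl ` A \<longleftrightarrow> Inr x \<in> A" for x and A :: "('a + 'a) set"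
    using flip_mem[of "Inl x" A] by simp
  then show ?thesis by (simp add: coker_part_def ker_part_def flip_part_def)
qed

text \<open>
  A kernel-saturated set \<open>U\<close> is the upper part of the union of all blocks that meet it in an
  upper vertex.
\<close>

lemma Domain_sat_rel:
  assumes a: "\<alpha> \<in> partitions X"
  shows "Domain (sat_rel X \<alpha>) = saturated X (ker_part \<alpha>)"
proof (intro equalityI subsetI)
  fix U assume "U \<in> Domain (sat_rel X \<alpha>)"
  then obtain L where s: "(U, L) \<in> sat_rel X \<alpha>" by blast
  then show "U \<in> saturated X (ker_part \<alpha>)"
    using sat_relD[OF s] by (auto simp: saturated_def ker_part_def sat_rel_def)
next
  fix U assume U: "U \<in> saturated X (ker_part \<alpha>)"
  define S where "S = \<Union> {A \<in> \<alpha>. \<exists>x\<in>U. Inl x \<in> A}"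
  have S: "S = U <+> Inr -` S"
  proof -
    have "Inl x \<in> S \<longleftrightarrow> x \<in> U" for x
    proof
      assume "Inl x \<in> S"
      then obtain A y where "A \<in> \<alpha>" "y \<in> U" "Inl y \<in> A" "Inl x \<in> A" unfolding S_def by blast
      then have "(y, x) \<in> ker_part \<alpha>" by (auto simp: ker_part_def)
      then show "x \<in> U" using U \<open>y \<in> U\<close> by (auto simp: saturated_def)
    next
      assume x: "x \<in> U"
      then have "Inl x \<in> X <+> X" using U by (auto simp: saturated_def)
      then obtain A where "A \<in> \<alpha>" "Inl x \<in> A" using partitions_ex_block[OF a] by blast
      then show "Inl x \<in> S" using x unfolding S_def by blast
    qed
    then have "Inl -` S = U" by auto
    then show ?thesis using Plus_vimage[of S] by simp
  qed
  have "S \<subseteq> X <+> X" using partitions_block_subset[OF a] unfolding S_def by blast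
  have "(U, Inr -` S) \<in> sat_rel X \<alpha>"
  proof (intro sat_relI)
    fix A u v assume A: "A \<in> \<alpha>" "u \<in> A" "v \<in> A" and "u \<in> U <+> Inr -` S"
    with S have "u \<in> S" by simp
    with A have "v \<in> S" unfolding S_def using partitions_unique_block[OF a] by blast
    with S show "v \<in> U <+> Inr -` S" by simp
  qed (use U \<open>S \<subseteq> X <+> X\<close> in \<open>auto simp: saturated_def\<close>)
  then show "U \<in> Domain (sat_rel X \<alpha>)" by blast
qed

lemma Range_sat_rel:
  assumes "\<alpha> \<in> partitions X"
  shows "Range (sat_rel X \<alpha>) = saturated X (coker_part \<alpha>)"
  using Domain_sat_rel[OF flip_closed[OF assms]] by (simp add: sat_rel_flip coker_part_flip)

section \<open>The dual symmetric inverse monoid and its idempotents\<close>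

lemma dom_part_subset: "\<alpha> \<in> partitions X \<Longrightarrow> dom_part \<alpha> \<subseteq> X"
  using partitions_block_subset unfolding dom_part_def by blast

text \<open>
  A block without lower vertices would itself be a union of blocks with empty lower part.
\<close>

lemma dom_part_eqI:
  assumes a: "\<alpha> \<in> partitions X" and triv: "\<And>U. (U, {}) \<in> sat_rel X \<alpha> \<Longrightarrow> U = {}"
  shows "dom_part \<alpha> = X"
proof
  show "dom_part \<alpha> \<subseteq> X" using a by (rule dom_part_subset)
  show "X \<subseteq> dom_part \<alpha>"
  proof
    fix x assume "x \<in> X"
    then obtain A where A: "A \<in> \<alpha>" "Inl x \<in> A" using partitions_ex_block[OF a] by blast
    have "transversal A"
    proof (rule ccontr)
      assume "\<not> transversal A"
      with A have "Inr -` A = {}" by (auto simp: transversal_def)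
      then have "(Inl -` A, {}) \<in> sat_rel X \<alpha>"
        using sat_rel_block[OF a, of "Inl -` A" "Inr -` A"] A(1) Plus_vimage[of A] by simp
      then have "Inl -` A = {}" by (rule triv)
      with A(2) show False by blast
    qed
    with A show "x \<in> dom_part \<alpha>" by (auto simp: dom_part_def)
  qed
qed

text \<open>
  If every upper vertex is joined to some lower vertex, then the lower part of a union of
  blocks decides which upper vertices belong to it.
\<close>

lemma sat_rel_left_unique:
  assumes a: "\<alpha> \<in> partitions X" and dom: "dom_part \<alpha> = X"
    and UL: "(U, L) \<in> sat_rel X \<alpha>" and VL: "(V, L) \<in> sat_rel X \<alpha>"
  shows "U \<subseteq> V"
proof
  fix x assume x: "x \<in> U"
  then have "x \<in> dom_part \<alpha>" using UL dom by (auto simp: sat_rel_def)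
  then obtain A y where A: "A \<in> \<alpha>" "Inl x \<in> A" "Inr y \<in> A"
    by (auto simp: dom_part_def transversal_def)
  have "y \<in> L" using sat_relD[OF UL A(1,2)] x A(3) by blast
  then show "x \<in> V" using sat_relD[OF VL A(1,3)] A(2) by blast
qed

lemma dom_part_iff:
  assumes a: "\<alpha> \<in> partitions X"
  shows "dom_part \<alpha> = X \<longleftrightarrow> single_valued ((sat_rel X \<alpha>)\<inverse>)"
proof
  assume "dom_part \<alpha> = X"
  from sat_rel_left_unique[OF a this] show "single_valued ((sat_rel X \<alpha>)\<inverse>)"
    unfolding single_valued_def by blast
next
  assume "single_valued ((sat_rel X \<alpha>)\<inverse>)"
  then show "dom_part \<alpha> = X"
    using sat_rel_empty[of X \<alpha>] by (intro dom_part_eqI[OF a]) (auto simp: single_valued_def)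
qed

lemma codom_part_flip: "codom_part \<alpha> = dom_part (flip_part \<alpha>)"
proof -
  have mem: "Inl x \<in> case_sum Inr Inl ` A \<longleftrightarrow> Inr x \<in> A" "Inr x \<in> case_sum Inr Inl ` A \<longleftrightarrow> Inl x \<in> A"
    for x and A :: "('a + 'a) set"
    using flip_mem[of "Inl x" A] flip_mem[of "Inr x" A] by simp_all
  have "transversal A \<longleftrightarrow> (\<exists>x. Inl x \<in> A) \<and> (\<exists>y. Inr y \<in> A)" for A :: "('a + 'a) set"
    by (auto simp: transversal_def)
  then show ?thesis unfolding codom_part_def dom_part_def flip_part_def by (auto simp: mem)
qed

lemma codom_part_iff:
  assumes "\<alpha> \<in> partitions X"
  shows "codom_part \<alpha> = X \<longleftrightarrow> single_valued (sat_rel X \<alpha>)"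
  using dom_part_iff[OF flip_closed[OF assms]] by (simp add: codom_part_flip sat_rel_flip)

lemma dual_sym_inv_iff:
  "\<alpha> \<in> dual_sym_inv X \<longleftrightarrow>
     \<alpha> \<in> partitions X \<and> single_valued (sat_rel X \<alpha>) \<and> single_valued ((sat_rel X \<alpha>)\<inverse>)"
  using dom_part_iff codom_part_iff unfolding dual_sym_inv_def by blast

lemma id_equiv_dual_sym_inv: "equiv X \<epsilon> \<Longrightarrow> id_equiv X \<epsilon> \<in> dual_sym_inv X"
  by (auto simp: dual_sym_inv_iff id_equiv_closed sat_rel_id_equiv single_valued_def)

text \<open>
  An idempotent partial bijection \<open>f\<close> is a partial identity: if \<open>(U, L) \<in> f\<close>, there is \<open>M\<close> with
  \<open>(U, M) \<in> f\<close> and \<open>(M, L) \<in> f\<close>, whence \<open>M = U\<close> by injectivity and then \<open>L = U\<close>.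
\<close>

lemma E_dual_sym_inv_eq: "E_dual_sym_inv X = {id_equiv X \<epsilon> | \<epsilon>. equiv X \<epsilon>}"
proof (intro equalityI subsetI)
  fix \<alpha> assume "\<alpha> \<in> E_dual_sym_inv X"
  then have J: "\<alpha> \<in> dual_sym_inv X" and idem: "partition_mult X \<alpha> \<alpha> = \<alpha>"
    by (auto simp: E_dual_sym_inv_def idempotents_def partition_monoid_def)
  then have a: "\<alpha> \<in> partitions X" and inj: "single_valued ((sat_rel X \<alpha>)\<inverse>)"
    and sv: "single_valued (sat_rel X \<alpha>)"
    by (auto simp: dual_sym_inv_iff)
  let ?f = "sat_rel X \<alpha>"
  have ff: "?f O ?f = ?f" using sat_rel_partition_mult[OF a a] idem by simp
  have "U = L" if "(U, L) \<in> ?f" for U L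
  proof -
    from that ff obtain M where "(U, M) \<in> ?f" "(M, L) \<in> ?f" by blast
    then have "(U, U) \<in> ?f" using inj that by (auto simp: single_valued_def)
    then show ?thesis using sv that by (auto simp: single_valued_def)
  qed
  then have "?f = Id_on (Domain ?f)" by auto
  also have "\<dots> = sat_rel X (id_equiv X (ker_part \<alpha>))"
    by (simp add: Domain_sat_rel[OF a] sat_rel_id_equiv[OF equiv_ker_part[OF a]])
  finally have "\<alpha> = id_equiv X (ker_part \<alpha>)"
    using a id_equiv_closed[OF equiv_ker_part[OF a]] by (intro sat_rel_inject[of _ X])
  then show "\<alpha> \<in> {id_equiv X \<epsilon> | \<epsilon>. equiv X \<epsilon>}" using equiv_ker_part[OF a] by blast
next
  fix \<alpha> assume "\<alpha> \<in> {id_equiv X \<epsilon> | \<epsilon>. equiv X \<epsilon>}"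
  then obtain \<epsilon> where e: "equiv X \<epsilon>" and eq: "\<alpha> = id_equiv X \<epsilon>" by blast
  have "partition_mult X \<alpha> \<alpha> = \<alpha>"
    unfolding eq using e
    by (intro sat_rel_inject[of _ X])
      (auto simp: partition_mult_closed id_equiv_closed sat_rel_partition_mult sat_rel_id_equiv)
  then show "\<alpha> \<in> E_dual_sym_inv X"
    using id_equiv_dual_sym_inv[OF e] eq
    by (simp add: E_dual_sym_inv_def idempotents_def partition_monoid_def)
qed

section \<open>The classes of the idempotents\<close>

lemma Id_on_relcomp_iff: "Id_on S O f = f \<longleftrightarrow> Domain f \<subseteq> S"
proof
  assume "Id_on S O f = f"
  then have "Domain f = Domain (Id_on S O f)" by simp
  then show "Domain f \<subseteq> S" by auto
qed auto

lemma relcomp_Id_on_iff: "f O Id_on S = f \<longleftrightarrow> Range f \<subseteq> S"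
proof
  assume "f O Id_on S = f"
  then have "Range f = Range (f O Id_on S)" by simp
  then show "Range f \<subseteq> S" by auto
qed auto

lemma id_equiv_mult_iff:
  assumes e: "equiv X \<epsilon>" and a: "\<alpha> \<in> partitions X"
  shows "partition_mult X (id_equiv X \<epsilon>) \<alpha> = \<alpha> \<longleftrightarrow> Domain (sat_rel X \<alpha>) \<subseteq> saturated X \<epsilon>"
proof -
  have "partition_mult X (id_equiv X \<epsilon>) \<alpha> = \<alpha> \<longleftrightarrow> Id_on (saturated X \<epsilon>) O sat_rel X \<alpha> = sat_rel X \<alpha>"
    using sat_rel_inject[OF partition_mult_closed a]
      sat_rel_partition_mult[OF id_equiv_closed[OF e] a] sat_rel_id_equiv[OF e] by metis
  also have "\<dots> \<longleftrightarrow> Domain (sat_rel X \<alpha>) \<subseteq> saturated X \<epsilon>" by (rule Id_on_relcomp_iff)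
  finally show ?thesis .
qed

lemma mult_id_equiv_iff:
  assumes e: "equiv X \<epsilon>" and a: "\<alpha> \<in> partitions X"
  shows "partition_mult X \<alpha> (id_equiv X \<epsilon>) = \<alpha> \<longleftrightarrow> Range (sat_rel X \<alpha>) \<subseteq> saturated X \<epsilon>"
proof -
  have "partition_mult X \<alpha> (id_equiv X \<epsilon>) = \<alpha> \<longleftrightarrow> sat_rel X \<alpha> O Id_on (saturated X \<epsilon>) = sat_rel X \<alpha>"
    using sat_rel_inject[OF partition_mult_closed a]
      sat_rel_partition_mult[OF a id_equiv_closed[OF e]] sat_rel_id_equiv[OF e] by metis
  also have "\<dots> \<longleftrightarrow> Range (sat_rel X \<alpha>) \<subseteq> saturated X \<epsilon>" by (rule relcomp_Id_on_iff)
  finally show ?thesis .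
qed

text \<open>
  An equivalence is recovered from its saturated sets, since the class of \<open>x\<close> is the least
  saturated set containing \<open>x\<close>.
\<close>

lemma saturated_inject:
  assumes "equiv X \<epsilon>" "equiv X \<delta>" "saturated X \<epsilon> = saturated X \<delta>"
  shows "\<epsilon> = \<delta>"
proof -
  have sub: "\<delta> \<subseteq> \<epsilon>" if e: "equiv X \<epsilon>" and d: "equiv X \<delta>" and eq: "saturated X \<epsilon> = saturated X \<delta>" for \<epsilon> \<delta>
  proof (rule subrelI)
    fix x y assume xy: "(x, y) \<in> \<delta>"
    have "\<epsilon> \<subseteq> X \<times> X" "trans \<epsilon>" using e by (auto simp: equiv_def)
    then have "\<epsilon> `` {x} \<in> saturated X \<epsilon>" by (auto simp: saturated_def dest: transD)
    then have "\<delta> `` (\<epsilon> `` {x}) \<subseteq> \<epsilon> `` {x}" unfolding eq by (simp add: saturated_def)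
    moreover have "x \<in> X" using xy d by (auto simp: equiv_def)
    then have "x \<in> \<epsilon> `` {x}" using equiv_class_self[OF e] by blast
    ultimately show "(x, y) \<in> \<epsilon>" using xy by blast
  qed
  from sub[OF assms] sub[OF assms(2,1) assms(3)[symmetric]] show ?thesis by blast
qed

lemma ker_part_id_equiv: "equiv X \<epsilon> \<Longrightarrow> ker_part (id_equiv X \<epsilon>) = \<epsilon>"
  by (intro saturated_inject[of X])
    (simp_all add: equiv_ker_part id_equiv_closed sat_rel_id_equiv flip: Domain_sat_rel)

lemma equiv_coker_part: "\<alpha> \<in> partitions X \<Longrightarrow> equiv X (coker_part \<alpha>)"
  by (simp add: coker_part_flip equiv_ker_part flip_closed)

lemma coker_part_id_equiv: "equiv X \<epsilon> \<Longrightarrow> coker_part (id_equiv X \<epsilon>) = \<epsilon>"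
  by (intro saturated_inject[of X])
    (simp_all add: equiv_coker_part id_equiv_closed sat_rel_id_equiv flip: Range_sat_rel)

text \<open>
  Finer equivalences have more saturated sets, so these are the \<open>id_equiv X \<delta>\<close> with \<open>\<delta> \<subseteq> \<epsilon>\<close>.
  The inclusion is stated with saturated sets because
  this is the form in which left and right identities of a partition are characterised.
\<close>

definition finer_ids :: "'a set \<Rightarrow> ('a \<times> 'a) set \<Rightarrow> ('a + 'a) set set set" where
  "finer_ids X \<epsilon> = {id_equiv X \<delta> | \<delta>. equiv X \<delta> \<and> saturated X \<epsilon> \<subseteq> saturated X \<delta>}"

lemma finer_ids_inject:
  assumes "equiv X \<epsilon>" "equiv X \<delta>" "finer_ids X \<epsilon> = finer_ids X \<delta>"
  shows "\<epsilon> = \<delta>"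
proof -
  have "saturated X \<delta> \<subseteq> saturated X \<epsilon>"
    if e: "equiv X \<epsilon>" and "equiv X \<delta>" and eq: "finer_ids X \<epsilon> = finer_ids X \<delta>" for \<epsilon> \<delta>
  proof -
    have "id_equiv X \<epsilon> \<in> finer_ids X \<epsilon>" using e by (auto simp: finer_ids_def)
    then obtain \<eta> where \<eta>: "id_equiv X \<epsilon> = id_equiv X \<eta>" "equiv X \<eta>" "saturated X \<delta> \<subseteq> saturated X \<eta>"
      unfolding eq by (auto simp: finer_ids_def)
    have "\<eta> = \<epsilon>" using ker_part_id_equiv[OF e] ker_part_id_equiv[OF \<eta>(2)] unfolding \<eta>(1) by simp
    then show ?thesis using \<eta>(3) by simp
  qed
  from this[OF assms] this[OF assms(2,1) assms(3)[symmetric]] have "saturated X \<epsilon> = saturated X \<delta>"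
    by (intro equalityI)
  then show ?thesis by (rule saturated_inject[OF assms(1,2)])
qed

lemma F_left_eq:
  assumes "\<alpha> \<in> partitions X"
  shows "F_left (partition_monoid X) (E_dual_sym_inv X) \<alpha> = finer_ids X (ker_part \<alpha>)"
  unfolding F_left_def E_dual_sym_inv_eq finer_ids_def partition_monoid_def
  using id_equiv_mult_iff[OF _ assms] Domain_sat_rel[OF assms] by (auto simp: eq_commute[of \<alpha>])

lemma F_right_eq:
  assumes "\<alpha> \<in> partitions X"
  shows "F_right (partition_monoid X) (E_dual_sym_inv X) \<alpha> = finer_ids X (coker_part \<alpha>)"
  unfolding F_right_def E_dual_sym_inv_eq finer_ids_def partition_monoid_def
  using mult_id_equiv_iff[OF _ assms] Range_sat_rel[OF assms] by (auto simp: eq_commute[of \<alpha>])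

text \<open>
  Left identities in \<open>F\<close> see exactly the kernel of a partition, right identities exactly its
  cokernel.
\<close>

lemma H_F_class_id_equiv:
  assumes e: "equiv X \<epsilon>"
  shows "H_F_class (partition_monoid X) (E_dual_sym_inv X) (id_equiv X \<epsilon>) =
    {\<alpha> \<in> partitions X. ker_part \<alpha> = \<epsilon> \<and> coker_part \<alpha> = \<epsilon>}"
proof -
  have "H_F (partition_monoid X) (E_dual_sym_inv X) \<alpha> (id_equiv X \<epsilon>) \<longleftrightarrow> ker_part \<alpha> = \<epsilon> \<and> coker_part \<alpha> = \<epsilon>"
    if a: "\<alpha> \<in> partitions X" for \<alpha>
    unfolding H_F_def R_F_def L_F_def F_left_eq[OF a] F_right_eq[OF a] F_left_eq[OF id_equiv_closed[OF e]]
      F_right_eq[OF id_equiv_closed[OF e]] ker_part_id_equiv[OF e] coker_part_id_equiv[OF e]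
    using finer_ids_inject[OF equiv_ker_part[OF a] e] finer_ids_inject[OF equiv_coker_part[OF a] e] by metis
  then show ?thesis by (auto simp: H_F_class_def partition_monoid_def)
qed

section \<open>The \<open>F\<close>-regular elements\<close>

lemma green_R_iff:
  assumes "monoid G" "a \<in> carrier G" "e \<in> carrier G"
  shows "green_R G a e \<longleftrightarrow> (\<exists>b\<in>carrier G. a = e \<otimes>\<^bsub>G\<^esub> b) \<and> (\<exists>c\<in>carrier G. e = a \<otimes>\<^bsub>G\<^esub> c)"
proof -
  interpret monoid G by fact
  have coset: "x <#\<^bsub>G\<^esub> carrier G = {x \<otimes>\<^bsub>G\<^esub> b | b. b \<in> carrier G}" for x
    by (auto simp: l_coset_def)
  have sub: "x <#\<^bsub>G\<^esub> carrier G \<subseteq> y <#\<^bsub>G\<^esub> carrier G \<longleftrightarrow> (\<exists>b\<in>carrier G. x = y \<otimes>\<^bsub>G\<^esub> b)"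
    if x: "x \<in> carrier G" and y: "y \<in> carrier G" for x y
  proof
    assume s: "x <#\<^bsub>G\<^esub> carrier G \<subseteq> y <#\<^bsub>G\<^esub> carrier G"
    have "x \<otimes>\<^bsub>G\<^esub> \<one>\<^bsub>G\<^esub> \<in> x <#\<^bsub>G\<^esub> carrier G" unfolding coset by blast
    then show "\<exists>b\<in>carrier G. x = y \<otimes>\<^bsub>G\<^esub> b" using s x unfolding coset by auto
  next
    assume "\<exists>b\<in>carrier G. x = y \<otimes>\<^bsub>G\<^esub> b"
    then obtain b where b: "b \<in> carrier G" "x = y \<otimes>\<^bsub>G\<^esub> b" by blast
    then show "x <#\<^bsub>G\<^esub> carrier G \<subseteq> y <#\<^bsub>G\<^esub> carrier G"
      unfolding coset using m_assoc[OF y] m_closed by auto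
  qed
  show ?thesis
    unfolding green_R_def set_eq_subset sub[OF assms(2,3)] sub[OF assms(3,2)] ..
qed

lemma green_L_iff:
  assumes "monoid G" "a \<in> carrier G" "e \<in> carrier G"
  shows "green_L G a e \<longleftrightarrow> (\<exists>b\<in>carrier G. a = b \<otimes>\<^bsub>G\<^esub> e) \<and> (\<exists>c\<in>carrier G. e = c \<otimes>\<^bsub>G\<^esub> a)"
proof -
  interpret monoid G by fact
  have coset: "carrier G #>\<^bsub>G\<^esub> x = {b \<otimes>\<^bsub>G\<^esub> x | b. b \<in> carrier G}" for x
    by (auto simp: r_coset_def)
  have sub: "carrier G #>\<^bsub>G\<^esub> x \<subseteq> carrier G #>\<^bsub>G\<^esub> y \<longleftrightarrow> (\<exists>b\<in>carrier G. x = b \<otimes>\<^bsub>G\<^esub> y)"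
    if x: "x \<in> carrier G" and y: "y \<in> carrier G" for x y
  proof
    assume s: "carrier G #>\<^bsub>G\<^esub> x \<subseteq> carrier G #>\<^bsub>G\<^esub> y"
    have "\<one>\<^bsub>G\<^esub> \<otimes>\<^bsub>G\<^esub> x \<in> carrier G #>\<^bsub>G\<^esub> x" unfolding coset by blast
    then show "\<exists>b\<in>carrier G. x = b \<otimes>\<^bsub>G\<^esub> y" using s x unfolding coset by auto
  next
    assume "\<exists>b\<in>carrier G. x = b \<otimes>\<^bsub>G\<^esub> y"
    then obtain b where b: "b \<in> carrier G" "x = b \<otimes>\<^bsub>G\<^esub> y" by blast
    then show "carrier G #>\<^bsub>G\<^esub> x \<subseteq> carrier G #>\<^bsub>G\<^esub> y"
      unfolding coset using m_assoc[symmetric, OF _ b(1) y] m_closed[OF _ b(1)] by auto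
  qed
  show ?thesis
    unfolding green_L_def set_eq_subset sub[OF assms(2,3)] sub[OF assms(3,2)] ..
qed

lemma relcomp_converse_eq_Id_on: "single_valued (f\<inverse>) \<Longrightarrow> f O f\<inverse> = Id_on (Domain f)"
  by (auto simp: single_valued_def)

lemma dual_sym_inv_mult_flip:
  assumes "\<alpha> \<in> dual_sym_inv X"
  shows "partition_mult X \<alpha> (flip_part \<alpha>) = id_equiv X (ker_part \<alpha>)"
    and "partition_mult X (flip_part \<alpha>) \<alpha> = id_equiv X (coker_part \<alpha>)"
proof -
  have a: "\<alpha> \<in> partitions X" and sv: "single_valued (sat_rel X \<alpha>)" "single_valued ((sat_rel X \<alpha>)\<inverse>)"
    using assms by (auto simp: dual_sym_inv_iff)
  have "sat_rel X \<alpha> O (sat_rel X \<alpha>)\<inverse> = Id_on (Domain (sat_rel X \<alpha>))"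
    "(sat_rel X \<alpha>)\<inverse> O sat_rel X \<alpha> = Id_on (Range (sat_rel X \<alpha>))"
    using sv relcomp_converse_eq_Id_on[of "sat_rel X \<alpha>"] relcomp_converse_eq_Id_on[of "(sat_rel X \<alpha>)\<inverse>"]
    by simp_all
  then show "partition_mult X \<alpha> (flip_part \<alpha>) = id_equiv X (ker_part \<alpha>)"
    "partition_mult X (flip_part \<alpha>) \<alpha> = id_equiv X (coker_part \<alpha>)"
    using a by (intro sat_rel_inject[of _ X]; simp add: partition_mult_closed id_equiv_closed
        equiv_ker_part equiv_coker_part sat_rel_partition_mult flip_closed sat_rel_flip sat_rel_id_equiv
        Domain_sat_rel Range_sat_rel)+
qed

text \<open>
  A union of blocks of \<open>\<alpha>\<close> without lower vertices remains a union of blocks of \<open>\<alpha>\<beta>\<close> without lower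
  vertices, since \<open>({}, {})\<close> belongs to every \<open>sat_rel X \<beta>\<close>.
\<close>

lemma dom_part_mult_eq:
  assumes a: "\<alpha> \<in> partitions X" and b: "\<beta> \<in> partitions X"
    and dom: "dom_part (partition_mult X \<alpha> \<beta>) = X"
  shows "dom_part \<alpha> = X"
proof (rule dom_part_eqI[OF a])
  fix U assume "(U, {}) \<in> sat_rel X \<alpha>"
  then have "(U, {}) \<in> sat_rel X (partition_mult X \<alpha> \<beta>)"
    using sat_rel_empty[of X \<beta>] sat_rel_partition_mult[OF a b] by blast
  from sat_rel_left_unique[OF partition_mult_closed dom this sat_rel_empty] show "U = {}" by simp
qed

lemma codom_part_mult_eq:
  assumes a: "\<alpha> \<in> partitions X" and b: "\<beta> \<in> partitions X"
    and codom: "codom_part (partition_mult X \<alpha> \<beta>) = X"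
  shows "codom_part \<beta> = X"
proof -
  have "flip_part (partition_mult X \<alpha> \<beta>) = partition_mult X (flip_part \<beta>) (flip_part \<alpha>)"
    using a b by (intro sat_rel_inject[of _ X])
      (simp_all add: flip_closed partition_mult_closed sat_rel_flip sat_rel_partition_mult converse_relcomp)
  then show ?thesis
    using codom dom_part_mult_eq[OF flip_closed[OF b] flip_closed[OF a]] by (simp add: codom_part_flip)
qed

lemma Reg_F_eq_dual_sym_inv: "Reg_F (partition_monoid X) (E_dual_sym_inv X) = dual_sym_inv X"
proof (intro equalityI subsetI)
  let ?P = "partition_monoid X"
  have P: "carrier ?P = partitions X" "mult ?P = partition_mult X" by (simp_all add: partition_monoid_def)
  fix \<alpha> assume "\<alpha> \<in> Reg_F ?P (E_dual_sym_inv X)"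
  then obtain \<epsilon> \<delta> where a: "\<alpha> \<in> partitions X" and e: "equiv X \<epsilon>" "green_R ?P \<alpha> (id_equiv X \<epsilon>)"
    and d: "equiv X \<delta>" "green_L ?P \<alpha> (id_equiv X \<delta>)"
    by (auto simp: Reg_F_def E_dual_sym_inv_eq P)
  obtain \<gamma> where "\<gamma> \<in> partitions X" "id_equiv X \<epsilon> = partition_mult X \<alpha> \<gamma>"
    using e(2) a id_equiv_closed[OF e(1)] by (auto simp: green_R_iff monoid_partition_monoid P)
  then have "dom_part \<alpha> = X"
    using dom_part_mult_eq[OF a] id_equiv_dual_sym_inv[OF e(1)] by (simp add: dual_sym_inv_def)
  obtain \<gamma> where "\<gamma> \<in> partitions X" "id_equiv X \<delta> = partition_mult X \<gamma> \<alpha>"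
    using d(2) a id_equiv_closed[OF d(1)] by (auto simp: green_L_iff monoid_partition_monoid P)
  then have "codom_part \<alpha> = X"
    using codom_part_mult_eq[OF _ a] id_equiv_dual_sym_inv[OF d(1)] by (simp add: dual_sym_inv_def)
  show "\<alpha> \<in> dual_sym_inv X"
    using a \<open>dom_part \<alpha> = X\<close> \<open>codom_part \<alpha> = X\<close> by (simp add: dual_sym_inv_def)
next
  let ?P = "partition_monoid X"
  have P: "carrier ?P = partitions X" "mult ?P = partition_mult X" by (simp_all add: partition_monoid_def)
  fix \<alpha> assume J: "\<alpha> \<in> dual_sym_inv X"
  then have a: "\<alpha> \<in> partitions X" by (simp add: dual_sym_inv_def)
  note k = equiv_ker_part[OF a] and c = equiv_coker_part[OF a]
  have "\<alpha> = partition_mult X (id_equiv X (ker_part \<alpha>)) \<alpha>"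
    using id_equiv_mult_iff[OF k a] Domain_sat_rel[OF a] by simp
  then have "green_R ?P \<alpha> (id_equiv X (ker_part \<alpha>))"
    using a flip_closed[OF a] id_equiv_closed[OF k] dual_sym_inv_mult_flip(1)[OF J, symmetric]
    by (subst green_R_iff) (auto simp: monoid_partition_monoid P)
  moreover have "\<alpha> = partition_mult X \<alpha> (id_equiv X (coker_part \<alpha>))"
    using mult_id_equiv_iff[OF c a] Range_sat_rel[OF a] by simp
  then have "green_L ?P \<alpha> (id_equiv X (coker_part \<alpha>))"
    using a flip_closed[OF a] id_equiv_closed[OF c] dual_sym_inv_mult_flip(2)[OF J, symmetric]
    by (subst green_L_iff) (auto simp: monoid_partition_monoid P)
  ultimately show "\<alpha> \<in> Reg_F ?P (E_dual_sym_inv X)"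
    using a k c by (auto simp: Reg_F_def E_dual_sym_inv_eq P)
qed

lemma partial_bijection_inverse_unique:
  fixes f g :: "'a rel"
  assumes "single_valued f" "single_valued (f\<inverse>)" "single_valued g" "single_valued (g\<inverse>)"
    and fgf: "f O g O f = f" and gfg: "g O f O g = g"
  shows "g = f\<inverse>"
proof -
  have sub: "f\<inverse> \<subseteq> g" if "f O g O f = f" "single_valued f" "single_valued (f\<inverse>)" for f g :: "'a rel"
  proof (rule subrelI)
    fix y x assume "(y, x) \<in> f\<inverse>"
    then have xy: "(x, y) \<in> f" by simp
    with that(1) have "(x, y) \<in> f O g O f" by simp
    then obtain u v where uv: "(x, u) \<in> f" "(u, v) \<in> g" "(v, y) \<in> f" by blast
    have "u = y" using uv(1) xy that(2) by (auto simp: single_valued_def)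
    moreover have "v = x" using uv(3) xy that(3) by (auto simp: single_valued_def)
    ultimately show "(y, x) \<in> g" using uv(2) by simp
  qed
  have "f\<inverse> \<subseteq> g" using sub[OF fgf] assms by blast
  moreover have "g\<inverse> \<subseteq> f" using sub[OF gfg] assms by blast
  ultimately show ?thesis by auto
qed

text \<open>
  Partial bijections are closed under composition and converse, and the converse is the only
  inverse of a partial bijection among partial bijections.
\<close>

lemma inverse_monoid_dual_sym_inv: "inverse_monoid (partition_monoid X\<lparr>carrier := dual_sym_inv X\<rparr>)"
proof -
  let ?P = "partition_monoid X" and ?J = "partition_monoid X\<lparr>carrier := dual_sym_inv X\<rparr>"
  interpret P: monoid ?P by (rule monoid_partition_monoid)
  have P: "carrier ?P = partitions X" "mult ?P = partition_mult X" "one ?P = id_equiv X (Id_on X)"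
    by (simp_all add: partition_monoid_def)
  have J: "carrier ?J = dual_sym_inv X" "mult ?J = partition_mult X" by (simp_all add: P)
  have part: "\<alpha> \<in> partitions X" if "\<alpha> \<in> dual_sym_inv X" for \<alpha>
    using that by (simp add: dual_sym_inv_def)
  have "submonoid (dual_sym_inv X) ?P"
  proof
    fix \<alpha> \<beta> assume *: "\<alpha> \<in> dual_sym_inv X" "\<beta> \<in> dual_sym_inv X"
    then show "\<alpha> \<otimes>\<^bsub>?P\<^esub> \<beta> \<in> dual_sym_inv X"
      by (simp add: P dual_sym_inv_iff partition_mult_closed sat_rel_partition_mult converse_relcomp
          single_valued_relcomp)
  qed (auto simp: P part id_equiv_dual_sym_inv equiv_Id_on)
  then have mon: "monoid ?J" by (rule submonoid.submonoid_is_monoid) (rule P.monoid_axioms)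
  have rel: "partition_mult X (partition_mult X \<alpha> \<beta>) \<alpha> = \<alpha> \<longleftrightarrow>
      sat_rel X \<alpha> O sat_rel X \<beta> O sat_rel X \<alpha> = sat_rel X \<alpha>"
    if "\<alpha> \<in> partitions X" "\<beta> \<in> partitions X" for \<alpha> \<beta>
    using sat_rel_inject[OF partition_mult_closed that(1)] that
    by (metis O_assoc partition_mult_closed sat_rel_partition_mult)
  have "\<exists>!\<beta>. \<beta> \<in> dual_sym_inv X \<and> partition_mult X (partition_mult X \<alpha> \<beta>) \<alpha> = \<alpha> \<and>
      partition_mult X (partition_mult X \<beta> \<alpha>) \<beta> = \<beta>"
    if \<alpha>: "\<alpha> \<in> dual_sym_inv X" for \<alpha>
  proof (rule ex1I[of _ "flip_part \<alpha>"])
    have a: "\<alpha> \<in> partitions X" and sv: "single_valued (sat_rel X \<alpha>)" "single_valued ((sat_rel X \<alpha>)\<inverse>)"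
      using \<alpha> by (auto simp: dual_sym_inv_iff)
    have "sat_rel X \<alpha> O (sat_rel X \<alpha>)\<inverse> O sat_rel X \<alpha> = sat_rel X \<alpha>"
      "(sat_rel X \<alpha>)\<inverse> O sat_rel X \<alpha> O (sat_rel X \<alpha>)\<inverse> = (sat_rel X \<alpha>)\<inverse>"
      using sv relcomp_converse_eq_Id_on[of "sat_rel X \<alpha>"] relcomp_converse_eq_Id_on[of "(sat_rel X \<alpha>)\<inverse>"]
      by (simp_all add: relcomp_Id_on_iff)
    then show "flip_part \<alpha> \<in> dual_sym_inv X \<and>
        partition_mult X (partition_mult X \<alpha> (flip_part \<alpha>)) \<alpha> = \<alpha> \<and>
        partition_mult X (partition_mult X (flip_part \<alpha>) \<alpha>) (flip_part \<alpha>) = flip_part \<alpha>"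
      using a sv by (simp add: rel flip_closed sat_rel_flip dual_sym_inv_iff)
    fix \<beta> assume \<beta>: "\<beta> \<in> dual_sym_inv X \<and> partition_mult X (partition_mult X \<alpha> \<beta>) \<alpha> = \<alpha> \<and>
        partition_mult X (partition_mult X \<beta> \<alpha>) \<beta> = \<beta>"
    then have b: "\<beta> \<in> partitions X" "single_valued (sat_rel X \<beta>)" "single_valued ((sat_rel X \<beta>)\<inverse>)"
      by (auto simp: dual_sym_inv_iff)
    have "sat_rel X \<beta> = (sat_rel X \<alpha>)\<inverse>"
      using \<beta> sv b a by (intro partial_bijection_inverse_unique) (simp_all add: rel)
    then show "\<beta> = flip_part \<alpha>"
      using a b by (intro sat_rel_inject[of _ X]) (simp_all add: flip_closed sat_rel_flip)
  qed
  then show ?thesis using mon unfolding inverse_monoid_def J by blast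
qed

section \<open>Partitions with equal kernel and cokernel as partial bijections\<close>

definition transversal_rel :: "('a + 'a) set set \<Rightarrow> ('a set \<times> 'a set) set" where
  "transversal_rel \<alpha> = {(A, B). A \<noteq> {} \<and> B \<noteq> {} \<and> A <+> B \<in> \<alpha>}"

text \<open>
  Unmatched classes are paired with the empty set, so that transversals and other blocks can be
  treated alike, as sets \<open>A <+> B\<close>.
\<close>

definition completion :: "'b set set \<Rightarrow> ('b set \<times> 'b set) set \<Rightarrow> ('b set \<times> 'b set) set" where
  "completion Y f = f \<union> (Y - Domain f) \<times> {{}} \<union> {{}} \<times> (Y - Range f)"

definition partition_of :: "'a set set \<Rightarrow> ('a set \<times> 'a set) set \<Rightarrow> ('a + 'a) set set" where
  "partition_of Y f = (\<lambda>(A, B). A <+> B) ` completion Y f"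

lemma block_upper_class:
  assumes "\<alpha> \<in> partitions X" "A <+> B \<in> \<alpha>" "A \<noteq> {}"
  shows "A \<in> X // ker_part \<alpha>"
proof -
  obtain x where x: "x \<in> A" using assms(3) by blast
  then have "ker_part \<alpha> `` {x} = A"
    using partitions_unique_block[OF assms(1) _ assms(2), of _ "Inl x"] assms(2)
    by (auto simp: ker_part_def)
  moreover have "x \<in> X" using partitions_block_subset[OF assms(1,2)] x by blast
  ultimately show ?thesis by (metis quotientI)
qed

lemma block_lower_class:
  assumes "\<alpha> \<in> partitions X" "A <+> B \<in> \<alpha>" "B \<noteq> {}"
  shows "B \<in> X // coker_part \<alpha>"
proof -
  obtain x where x: "x \<in> B" using assms(3) by blast
  then have "coker_part \<alpha> `` {x} = B"
    using partitions_unique_block[OF assms(1) _ assms(2), of _ "Inr x"] assms(2)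
    by (auto simp: coker_part_def)
  moreover have "x \<in> X" using partitions_block_subset[OF assms(1,2)] x by blast
  ultimately show ?thesis by (metis quotientI)
qed

lemma upper_class_block:
  assumes a: "\<alpha> \<in> partitions X" and A: "A \<in> X // ker_part \<alpha>"
  obtains B where "A <+> B \<in> \<alpha>"
proof -
  obtain x where x: "x \<in> X" "A = ker_part \<alpha> `` {x}" using A by (rule quotientE)
  obtain S where S: "S \<in> \<alpha>" "Inl x \<in> S" using partitions_ex_block[OF a] x(1) by blast
  have "y \<in> Inl -` S \<longleftrightarrow> (x, y) \<in> ker_part \<alpha>" for y
    using partitions_unique_block[OF a _ S(1) _ S(2)] S unfolding ker_part_def by blast
  then have "Inl -` S = A" unfolding x(2) by blast
  with S(1) Plus_vimage[of S] show ?thesis by (intro that[of "Inr -` S"]) simp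
qed

lemma lower_class_block:
  assumes a: "\<alpha> \<in> partitions X" and B: "B \<in> X // coker_part \<alpha>"
  obtains A where "A <+> B \<in> \<alpha>"
proof -
  obtain x where x: "x \<in> X" "B = coker_part \<alpha> `` {x}" using B by (rule quotientE)
  obtain S where S: "S \<in> \<alpha>" "Inr x \<in> S" using partitions_ex_block[OF a] x(1) by blast
  have "y \<in> Inr -` S \<longleftrightarrow> (x, y) \<in> coker_part \<alpha>" for y
    using partitions_unique_block[OF a _ S(1) _ S(2)] S unfolding coker_part_def by blast
  then have "Inr -` S = B" unfolding x(2) by blast
  with S(1) Plus_vimage[of S] show ?thesis by (intro that[of "Inl -` S"]) simp
qed

lemma block_eq_upper:
  assumes "\<alpha> \<in> partitions X" "A <+> B \<in> \<alpha>" "A <+> C \<in> \<alpha>" "A \<noteq> {}"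
  shows "B = C"
proof -
  obtain x where "x \<in> A" using assms(4) by blast
  then have "A <+> B = A <+> C" by (intro partitions_unique_block[OF assms(1-3), of "Inl x"]) auto
  then show ?thesis by (simp add: Plus_eq_iff)
qed

lemma block_eq_lower:
  assumes "\<alpha> \<in> partitions X" "A <+> C \<in> \<alpha>" "B <+> C \<in> \<alpha>" "C \<noteq> {}"
  shows "A = B"
proof -
  obtain x where "x \<in> C" using assms(4) by blast
  then have "A <+> C = B <+> C" by (intro partitions_unique_block[OF assms(1-3), of "Inr x"]) auto
  then show ?thesis by (simp add: Plus_eq_iff)
qed

lemma quotient_subset_eq:
  assumes "equiv X \<epsilon>" "A \<in> X // \<epsilon>" "B \<in> X // \<epsilon>" "A \<subseteq> B"
  shows "A = B"
  using quotient_disj[OF assms(1-3)] in_quotient_imp_non_empty[OF assms(1,2)] assms(4) by blast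

lemma sat_rel_upper_block:
  assumes "(A, M) \<in> sat_rel X \<alpha>" "A' <+> C \<in> \<alpha>" "A' \<inter> A \<noteq> {}"
  shows "A' \<subseteq> A \<and> C \<subseteq> M"
proof -
  obtain x where "x \<in> A'" "x \<in> A" using assms(3) by blast
  then have "A' <+> C \<subseteq> A <+> M" by (intro sat_relD[OF assms(1,2), of "Inl x"]) auto
  then show ?thesis by auto
qed

text \<open>
  When the range of \<open>f\<close> equals the domain of \<open>g\<close>, the composition \<open>f O g\<close> has the domain of \<open>f\<close> and
  the range of \<open>g\<close>.
\<close>

lemma ker_coker_part_mult:
  assumes a: "\<alpha> \<in> partitions X" and b: "\<beta> \<in> partitions X" and eq: "coker_part \<alpha> = ker_part \<beta>"
  shows "ker_part (partition_mult X \<alpha> \<beta>) = ker_part \<alpha>"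
    and "coker_part (partition_mult X \<alpha> \<beta>) = coker_part \<beta>"
proof -
  note ab = partition_mult_closed[of X \<alpha> \<beta>]
  let ?f = "sat_rel X \<alpha>" and ?g = "sat_rel X \<beta>"
  have "Range ?f = Domain ?g" using Range_sat_rel[OF a] Domain_sat_rel[OF b] eq by simp
  then have "Domain (?f O ?g) = Domain ?f" "Range (?f O ?g) = Range ?g" by blast+
  then have "saturated X (ker_part (partition_mult X \<alpha> \<beta>)) = saturated X (ker_part \<alpha>)"
    "saturated X (coker_part (partition_mult X \<alpha> \<beta>)) = saturated X (coker_part \<beta>)"
    by (simp_all add: a b ab sat_rel_partition_mult flip: Domain_sat_rel Range_sat_rel)
  then show "ker_part (partition_mult X \<alpha> \<beta>) = ker_part \<alpha>"
    "coker_part (partition_mult X \<alpha> \<beta>) = coker_part \<beta>"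
    using saturated_inject[OF equiv_ker_part[OF ab] equiv_ker_part[OF a]]
      saturated_inject[OF equiv_coker_part[OF ab] equiv_coker_part[OF b]] by simp_all
qed

text \<open>
  Transversals match up along equal middle classes. If \<open>A <+> B\<close> is a block of the product, then
  the block of \<open>\<alpha>\<close> with upper part \<open>A\<close> has as lower part a class \<open>C\<close>, and the block of \<open>\<beta>\<close> with
  upper part \<open>C\<close> has as lower part a class \<open>D\<close>; otherwise \<open>A\<close> alone would be a union of blocks of the product. Conversely, a transversal of
  \<open>\<alpha>\<close> followed by one of \<open>\<beta>\<close> forces the block of the product at its upper class to reach its lower
  class. In both directions the lower class found contains \<open>B\<close>, and distinct classes are disjoint.
\<close>

lemma transversal_rel_mult:
  assumes a: "\<alpha> \<in> partitions X" and b: "\<beta> \<in> partitions X" and eq: "coker_part \<alpha> = ker_part \<beta>"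
  shows "transversal_rel (partition_mult X \<alpha> \<beta>) = transversal_rel \<alpha> O transversal_rel \<beta>"
proof (intro equalityI subrelI)
  let ?\<gamma> = "partition_mult X \<alpha> \<beta>"
  note c = partition_mult_closed[of X \<alpha> \<beta>] and rel = sat_rel_partition_mult[OF a b]
  fix A B assume "(A, B) \<in> transversal_rel ?\<gamma>"
  then have ne: "A \<noteq> {}" "B \<noteq> {}" and AB: "A <+> B \<in> ?\<gamma>" by (auto simp: transversal_rel_def)
  \<comment> \<open>The class \<open>A\<close> is not a dead end, because its block contains lower vertices.\<close>
  have not_sat: "(A, {}) \<notin> sat_rel X ?\<gamma>"
    using sat_rel_upper_block[of A "{}" X ?\<gamma> A B] AB ne by auto
  have "A \<in> X // ker_part \<alpha>" using block_upper_class[OF c AB ne(1)] ker_coker_part_mult[OF assms] by simp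
  then obtain C where C: "A <+> C \<in> \<alpha>" using upper_class_block[OF a] by blast
  note AC = sat_rel_block[OF a C]
  have "C \<noteq> {}" using not_sat AC sat_rel_empty[of X \<beta>] unfolding rel by blast
  then have "C \<in> X // ker_part \<beta>" using block_lower_class[OF a C] eq by simp
  then obtain D where D: "C <+> D \<in> \<beta>" using upper_class_block[OF b] by blast
  note CD = sat_rel_block[OF b D]
  have "D \<noteq> {}" using not_sat AC CD unfolding rel by blast
  have "(A, D) \<in> sat_rel X ?\<gamma>" using AC CD unfolding rel by blast
  then have "B \<subseteq> D" using sat_rel_upper_block[OF _ AB] ne by blast
  moreover have "B \<in> X // coker_part \<beta>" "D \<in> X // coker_part \<beta>"
    using block_lower_class[OF c AB ne(2)] block_lower_class[OF b D \<open>D \<noteq> {}\<close>] ker_coker_part_mult[OF assms] by auto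
  ultimately have "B = D" using quotient_subset_eq[OF equiv_coker_part[OF b]] by blast
  then show "(A, B) \<in> transversal_rel \<alpha> O transversal_rel \<beta>"
    using ne C D \<open>C \<noteq> {}\<close> unfolding transversal_rel_def by blast
next
  let ?\<gamma> = "partition_mult X \<alpha> \<beta>"
  note c = partition_mult_closed[of X \<alpha> \<beta>] and rel = sat_rel_partition_mult[OF a b]
  fix A B assume "(A, B) \<in> transversal_rel \<alpha> O transversal_rel \<beta>"
  then obtain C where ne: "A \<noteq> {}" "C \<noteq> {}" "B \<noteq> {}" and AC: "A <+> C \<in> \<alpha>" and CB: "C <+> B \<in> \<beta>"
    by (auto simp: transversal_rel_def)
  have "A \<in> X // ker_part ?\<gamma>" using block_upper_class[OF a AC ne(1)] ker_coker_part_mult[OF assms] by simp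
  then obtain L where L: "A <+> L \<in> ?\<gamma>" using upper_class_block[OF c] by blast
  obtain M where M: "(A, M) \<in> sat_rel X \<alpha>" "(M, L) \<in> sat_rel X \<beta>"
    using sat_rel_block[OF c L] unfolding rel by blast
  have "C \<subseteq> M" using sat_rel_upper_block[OF M(1) AC] ne by blast
  then have "B \<subseteq> L" using sat_rel_upper_block[OF M(2) CB] ne by blast
  then have "L \<noteq> {}" using ne by blast
  have "B \<in> X // coker_part \<beta>" "L \<in> X // coker_part \<beta>"
    using block_lower_class[OF b CB ne(3)] block_lower_class[OF c L \<open>L \<noteq> {}\<close>] ker_coker_part_mult[OF assms] by auto
  with \<open>B \<subseteq> L\<close> have "B = L" using quotient_subset_eq[OF equiv_coker_part[OF b]] by blast
  then show "(A, B) \<in> transversal_rel ?\<gamma>" using L ne by (simp add: transversal_rel_def)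
qed

lemma transversal_rel_sym_inv:
  assumes "\<alpha> \<in> partitions X" "ker_part \<alpha> = \<epsilon>" "coker_part \<alpha> = \<epsilon>"
  shows "transversal_rel \<alpha> \<in> carrier (sym_inv_monoid (X // \<epsilon>))"
proof -
  have "single_valued (transversal_rel \<alpha>)" "single_valued ((transversal_rel \<alpha>)\<inverse>)"
    using block_eq_upper[OF assms(1)] block_eq_lower[OF assms(1)]
    unfolding single_valued_def transversal_rel_def by blast+
  moreover have "transversal_rel \<alpha> \<subseteq> (X // \<epsilon>) \<times> (X // \<epsilon>)"
    using block_upper_class[OF assms(1)] block_lower_class[OF assms(1)]
    unfolding transversal_rel_def assms(2,3) by blast
  ultimately show ?thesis by (simp add: sym_inv_monoid_def)
qed

text \<open>
  The blocks that are not transversals are the classes left over on either side, so the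
  transversals determine the partition.
\<close>

lemma partition_of_transversal_rel:
  assumes a: "\<alpha> \<in> partitions X" and k: "ker_part \<alpha> = \<epsilon>" "coker_part \<alpha> = \<epsilon>"
  shows "partition_of (X // \<epsilon>) (transversal_rel \<alpha>) = \<alpha>"
proof -
  let ?f = "transversal_rel \<alpha>"
  have ne: "{} \<notin> X // \<epsilon>" using equiv_ker_part[OF a] k in_quotient_imp_non_empty by blast
  have "(A, B) \<in> completion (X // \<epsilon>) ?f \<longleftrightarrow> A <+> B \<in> \<alpha>" for A B
  proof
    assume "(A, B) \<in> completion (X // \<epsilon>) ?f"
    then consider "(A, B) \<in> ?f" | "A \<in> X // \<epsilon>" "A \<notin> Domain ?f" "B = {}"
      | "B \<in> X // \<epsilon>" "B \<notin> Range ?f" "A = {}"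
      by (auto simp: completion_def)
    then show "A <+> B \<in> \<alpha>"
    proof cases
      case 1 then show ?thesis by (simp add: transversal_rel_def)
    next
      case 2
      then have "A \<in> X // ker_part \<alpha>" using k by simp
      then obtain C where "A <+> C \<in> \<alpha>" by (rule upper_class_block[OF a])
      moreover from this have "C = {}" using 2 ne by (auto simp: transversal_rel_def)
      ultimately show ?thesis using 2 by simp
    next
      case 3
      then have "B \<in> X // coker_part \<alpha>" using k by simp
      then obtain C where "C <+> B \<in> \<alpha>" by (rule lower_class_block[OF a])
      moreover from this have "C = {}" using 3 ne by (auto simp: transversal_rel_def)
      ultimately show ?thesis using 3 by simp
    qed
  next
    assume AB: "A <+> B \<in> \<alpha>"
    have "\<not> (A = {} \<and> B = {})"
    proof
      assume "A = {} \<and> B = {}"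
      then have "A <+> B = {}" by (simp only: Plus_eq_empty_conv)
      with a AB show False by (auto simp: partitions_def partition_on_def)
    qed
    then consider "A \<noteq> {}" "B \<noteq> {}" | "A \<noteq> {}" "B = {}" | "A = {}" "B \<noteq> {}" by blast
    then show "(A, B) \<in> completion (X // \<epsilon>) ?f"
    proof cases
      case 1 then show ?thesis using AB by (simp add: completion_def transversal_rel_def)
    next
      case 2
      then have "A \<in> X // \<epsilon>" using block_upper_class[OF a AB] k by simp
      moreover have "A \<notin> Domain ?f" using block_eq_upper[OF a _ AB] 2 by (auto simp: transversal_rel_def)
      ultimately show ?thesis using 2 by (simp add: completion_def)
    next
      case 3
      then have "B \<in> X // \<epsilon>" using block_lower_class[OF a AB] k by simp
      moreover have "B \<notin> Range ?f" using block_eq_lower[OF a _ AB] 3 by (auto simp: transversal_rel_def)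
      ultimately show ?thesis using 3 by (simp add: completion_def)
    qed
  qed
  then have "S \<in> partition_of (X // \<epsilon>) ?f \<longleftrightarrow> S \<in> \<alpha>" for S
    unfolding partition_of_def by (metis (no_types, lifting) Plus_vimage case_prod_conv image_iff surj_pair)
  then show ?thesis by blast
qed

text \<open>
  Every class occurs in exactly one pair of the completion on each side: in at least one by
  construction, in at most one because \<open>f\<close> is a partial bijection. Hence the blocks form a
  partition which cuts out the classes of \<open>\<epsilon>\<close> both above and below.
\<close>

lemma partition_of_partial_bijection:
  fixes X :: "'a set"
  assumes e: "equiv X \<epsilon>" and f: "f \<in> carrier (sym_inv_monoid (X // \<epsilon>))"
  shows "partition_of (X // \<epsilon>) f \<in> partitions X"
    and "ker_part (partition_of (X // \<epsilon>) f) = \<epsilon>"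
    and "coker_part (partition_of (X // \<epsilon>) f) = \<epsilon>"
    and "transversal_rel (partition_of (X // \<epsilon>) f) = f"
proof -
  let ?Y = "X // \<epsilon>" and ?c = "completion (X // \<epsilon>) f" and ?\<alpha> = "partition_of (X // \<epsilon>) f"
  have fY: "f \<subseteq> ?Y \<times> ?Y" and sv: "single_valued f" "single_valued (f\<inverse>)"
    using f by (auto simp: sym_inv_monoid_def)
  have ne: "{} \<notin> ?Y" using in_quotient_imp_non_empty[OF e] by blast
  have UY: "\<Union> ?Y = X" by (rule Union_quotient[OF e])
  have mem: "A <+> B \<in> ?\<alpha> \<longleftrightarrow> (A, B) \<in> ?c" for A B
    unfolding partition_of_def by (force simp: Plus_eq_iff)
  have form: "\<exists>A B. S = A <+> B \<and> (A, B) \<in> ?c" if "S \<in> ?\<alpha>" for S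
    using that by (auto simp: partition_of_def)
  have upY: "A \<in> ?Y" if "(A, B) \<in> ?c" "x \<in> A" for A B x
    using that fY by (auto simp: completion_def)
  have loY: "B \<in> ?Y" if "(A, B) \<in> ?c" "x \<in> B" for A B x
    using that fY by (auto simp: completion_def)
  have same: "A = B" if "A \<in> ?Y" "B \<in> ?Y" "x \<in> A" "x \<in> B" for A B x
    using quotient_disj[OF e that(1,2)] that(3,4) by blast
  have ex_up: "\<exists>B. (A, B) \<in> ?c" if "A \<in> ?Y" for A
    using that by (auto simp: completion_def)
  have ex_lo: "\<exists>A. (A, B) \<in> ?c" if "B \<in> ?Y" for B
    using that by (auto simp: completion_def)
  have un_up: "B = C" if "(A, B) \<in> ?c" "(A, C) \<in> ?c" "A \<noteq> {}" for A B C
    using that sv(1) by (auto simp: completion_def single_valued_def)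
  have un_lo: "A = B" if "(A, C) \<in> ?c" "(B, C) \<in> ?c" "C \<noteq> {}" for A B C
    using that sv(2) by (auto simp: completion_def single_valued_def)
  have class_of: "\<epsilon> `` {x} \<in> ?Y" "x \<in> \<epsilon> `` {x}" if "x \<in> X" for x
    using that equiv_class_self[OF e] by (auto intro: quotientI)
  show "?\<alpha> \<in> partitions X"
    unfolding partitions_def mem_Collect_eq
  proof (rule partition_onI)
    show "\<Union> ?\<alpha> = X <+> X"
    proof (intro equalityI subsetI)
      fix u assume "u \<in> \<Union> ?\<alpha>"
      then obtain A B where AB: "(A, B) \<in> ?c" "u \<in> A <+> B" using form by blast
      show "u \<in> X <+> X"
        using AB(2)
      proof
        fix x assume "u = Inl x" "x \<in> A"
        then show ?thesis using upY[OF AB(1)] UY by blast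
      next
        fix x assume "u = Inr x" "x \<in> B"
        then show ?thesis using loY[OF AB(1)] UY by blast
      qed
    next
      fix u assume "u \<in> X <+> X"
      then show "u \<in> \<Union> ?\<alpha>"
      proof
        fix x assume x: "u = Inl x" "x \<in> X"
        obtain B where "(\<epsilon> `` {x}, B) \<in> ?c" using ex_up class_of[OF x(2)] by blast
        then have "\<epsilon> `` {x} <+> B \<in> ?\<alpha>" by (simp add: mem)
        then show ?thesis using class_of(2)[OF x(2)] x(1) by blast
      next
        fix x assume x: "u = Inr x" "x \<in> X"
        obtain A where "(A, \<epsilon> `` {x}) \<in> ?c" using ex_lo class_of[OF x(2)] by blast
        then have "A <+> \<epsilon> `` {x} \<in> ?\<alpha>" by (simp add: mem)
        then show ?thesis using class_of(2)[OF x(2)] x(1) by blast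
      qed
    qed
    show "disjnt S T" if "S \<in> ?\<alpha>" "T \<in> ?\<alpha>" "S \<noteq> T" for S T
    proof (rule ccontr)
      assume "\<not> disjnt S T"
      then obtain u where u: "u \<in> S" "u \<in> T" by (auto simp: disjnt_def)
      from form[OF that(1)] obtain A B where S: "S = A <+> B" "(A, B) \<in> ?c" by auto
      from form[OF that(2)] obtain C D where T: "T = C <+> D" "(C, D) \<in> ?c" by auto
      have "S = T"
      proof (cases u)
        case (Inl x)
        then have x: "x \<in> A" "x \<in> C" using u S T by auto
        then have "A = C" using same upY S(2) T(2) by blast
        then show ?thesis using un_up[of A B D] x S T by blast
      next
        case (Inr x)
        then have x: "x \<in> B" "x \<in> D" using u S T by auto
        then have "B = D" using same loY S(2) T(2) by blast
        then show ?thesis using un_lo[of A B C] x S T by blast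
      qed
      with that(3) show False ..
    qed
    show "{} \<notin> ?\<alpha>"
    proof
      assume "{} \<in> ?\<alpha>"
      from form[OF this] obtain A B where "A <+> B = {}" "(A, B) \<in> ?c" by metis
      then have "({}, {}) \<in> ?c" by (simp add: Plus_eq_empty_conv)
      then show False using ne fY by (auto simp: completion_def)
    qed
  qed
  have eps: "(x, y) \<in> \<epsilon> \<longleftrightarrow> (\<exists>A\<in>?Y. x \<in> A \<and> y \<in> A)" for x y
    using in_quotient_imp_in_rel[OF e] class_of e
    by (metis Image_singleton_iff empty_subsetI equiv_class_eq_iff insert_subset)
  have "(x, y) \<in> ker_part ?\<alpha> \<longleftrightarrow> (\<exists>A\<in>?Y. x \<in> A \<and> y \<in> A)" for x y
  proof
    assume "(x, y) \<in> ker_part ?\<alpha>"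
    then obtain S where "S \<in> ?\<alpha>" "Inl x \<in> S" "Inl y \<in> S" by (auto simp: ker_part_def)
    then obtain A B where "(A, B) \<in> ?c" "x \<in> A" "y \<in> A" using form by blast
    then show "\<exists>A\<in>?Y. x \<in> A \<and> y \<in> A" using upY by blast
  next
    assume "\<exists>A\<in>?Y. x \<in> A \<and> y \<in> A"
    then obtain A B where "(A, B) \<in> ?c" "x \<in> A" "y \<in> A" using ex_up by blast
    then show "(x, y) \<in> ker_part ?\<alpha>" unfolding ker_part_def mem[symmetric] by blast
  qed
  then show "ker_part ?\<alpha> = \<epsilon>" using eps by (auto simp: set_eq_iff)
  have "(x, y) \<in> coker_part ?\<alpha> \<longleftrightarrow> (\<exists>A\<in>?Y. x \<in> A \<and> y \<in> A)" for x y
  proof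
    assume "(x, y) \<in> coker_part ?\<alpha>"
    then obtain S where "S \<in> ?\<alpha>" "Inr x \<in> S" "Inr y \<in> S" by (auto simp: coker_part_def)
    then obtain A B where "(A, B) \<in> ?c" "x \<in> B" "y \<in> B" using form by blast
    then show "\<exists>A\<in>?Y. x \<in> A \<and> y \<in> A" using loY by blast
  next
    assume "\<exists>A\<in>?Y. x \<in> A \<and> y \<in> A"
    then obtain A B where "(A, B) \<in> ?c" "x \<in> B" "y \<in> B" using ex_lo by blast
    then show "(x, y) \<in> coker_part ?\<alpha>" unfolding coker_part_def mem[symmetric] by blast
  qed
  then show "coker_part ?\<alpha> = \<epsilon>" using eps by (auto simp: set_eq_iff)
  show "transversal_rel ?\<alpha> = f"
    unfolding transversal_rel_def mem using fY ne by (auto simp: completion_def)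
qed

lemma H_F_class_monoid_iso:
  fixes X :: "'a set"
  defines "P \<equiv> partition_monoid X" and "F \<equiv> E_dual_sym_inv X"
  assumes e: "equiv X \<epsilon>"
  shows "monoid (P\<lparr>carrier := H_F_class P F (id_equiv X \<epsilon>), one := id_equiv X \<epsilon>\<rparr>)"
    and "P\<lparr>carrier := H_F_class P F (id_equiv X \<epsilon>), one := id_equiv X \<epsilon>\<rparr> \<cong> sym_inv_monoid (X // \<epsilon>)"
proof -
  let ?H = "{\<alpha> \<in> partitions X. ker_part \<alpha> = \<epsilon> \<and> coker_part \<alpha> = \<epsilon>}"
  let ?M = "P\<lparr>carrier := H_F_class P F (id_equiv X \<epsilon>), one := id_equiv X \<epsilon>\<rparr>"
  interpret P: monoid P unfolding P_def by (rule monoid_partition_monoid)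
  have P: "carrier P = partitions X" "mult P = partition_mult X"
    by (simp_all add: P_def partition_monoid_def)
  have M: "carrier ?M = ?H" "mult ?M = partition_mult X" "one ?M = id_equiv X \<epsilon>"
    using H_F_class_id_equiv[OF e] by (simp_all add: P_def F_def partition_monoid_def)
  have closed: "partition_mult X \<alpha> \<beta> \<in> ?H" if "\<alpha> \<in> ?H" "\<beta> \<in> ?H" for \<alpha> \<beta>
    using that by (auto simp: partition_mult_closed ker_coker_part_mult)
  show "monoid ?M"
  proof (rule monoidI; unfold M)
    show "id_equiv X \<epsilon> \<in> ?H"
      using e by (simp add: id_equiv_closed ker_part_id_equiv coker_part_id_equiv)
    fix \<alpha> assume "\<alpha> \<in> ?H"
    then show "partition_mult X (id_equiv X \<epsilon>) \<alpha> = \<alpha>" "partition_mult X \<alpha> (id_equiv X \<epsilon>) = \<alpha>"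
      using id_equiv_mult_iff[OF e, of \<alpha>] mult_id_equiv_iff[OF e, of \<alpha>]
        Domain_sat_rel[of \<alpha> X] Range_sat_rel[of \<alpha> X] by auto
  next
    fix \<alpha> \<beta> assume "\<alpha> \<in> ?H" "\<beta> \<in> ?H"
    then show "partition_mult X \<alpha> \<beta> \<in> ?H" by (rule closed)
  next
    fix \<alpha> \<beta> \<gamma> assume "\<alpha> \<in> ?H" "\<beta> \<in> ?H" "\<gamma> \<in> ?H"
    then show "partition_mult X (partition_mult X \<alpha> \<beta>) \<gamma> = partition_mult X \<alpha> (partition_mult X \<beta> \<gamma>)"
      using P.m_assoc[of \<alpha> \<beta> \<gamma>] by (simp add: P)
  qed
  have "transversal_rel \<in> iso ?M (sym_inv_monoid (X // \<epsilon>))"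
    unfolding iso_def hom_def mem_Collect_eq M
  proof (intro conjI ballI)
    show "transversal_rel \<in> ?H \<rightarrow> carrier (sym_inv_monoid (X // \<epsilon>))"
      using transversal_rel_sym_inv by blast
    fix \<alpha> \<beta> assume "\<alpha> \<in> ?H" "\<beta> \<in> ?H"
    then show "transversal_rel (partition_mult X \<alpha> \<beta>) =
        transversal_rel \<alpha> \<otimes>\<^bsub>sym_inv_monoid (X // \<epsilon>)\<^esub> transversal_rel \<beta>"
      by (simp add: transversal_rel_mult sym_inv_monoid_def)
  next
    show "bij_betw transversal_rel ?H (carrier (sym_inv_monoid (X // \<epsilon>)))"
    proof (rule bij_betw_byWitness[where f' = "partition_of (X // \<epsilon>)"])
      show "\<forall>\<alpha>\<in>?H. partition_of (X // \<epsilon>) (transversal_rel \<alpha>) = \<alpha>"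
        by (simp add: partition_of_transversal_rel)
      show "\<forall>f\<in>carrier (sym_inv_monoid (X // \<epsilon>)). transversal_rel (partition_of (X // \<epsilon>) f) = f"
        by (simp add: partition_of_partial_bijection[OF e])
      show "transversal_rel ` ?H \<subseteq> carrier (sym_inv_monoid (X // \<epsilon>))"
        by (auto intro: transversal_rel_sym_inv)
      show "partition_of (X // \<epsilon>) ` carrier (sym_inv_monoid (X // \<epsilon>)) \<subseteq> ?H"
        using partition_of_partial_bijection[OF e] by auto
    qed
  qed
  then show "?M \<cong> sym_inv_monoid (X // \<epsilon>)" unfolding is_iso_def by blast
qed

theorem proposition4p13:
  fixes X :: "'a set"
    and P :: "('a + 'a) set set monoid"
    and F :: "('a + 'a) set set set"
  assumes "P = partition_monoid X"
    and "F = E_dual_sym_inv X"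
  shows "(\<forall>\<epsilon>. equiv X \<epsilon> \<longrightarrow>
            monoid (P\<lparr>carrier := H_F_class P F (id_equiv X \<epsilon>), one := id_equiv X \<epsilon>\<rparr>) \<and>
            P\<lparr>carrier := H_F_class P F (id_equiv X \<epsilon>), one := id_equiv X \<epsilon>\<rparr>
              \<cong> sym_inv_monoid (X // \<epsilon>)) \<and>
         inverse_monoid (P\<lparr>carrier := Reg_F P F\<rparr>) \<and>
         Reg_F P F = dual_sym_inv X"
  unfolding assms
  using H_F_class_monoid_iso[of X] Reg_F_eq_dual_sym_inv[of X] inverse_monoid_dual_sym_inv[of X]
  by simp

end
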